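(* Let $\mu=\mu_{1/4}$, $\Gamma=\{\sum_{i=0}^m a_i4^i: m\ge0,\ a_i\in\{0,1\}\}$, and let $U$ be the unitary operator on $L^2(\mu)$ determined by $Ue_\gamma=e_{5\gamma}$ for $\gamma\in\Gamma$. Let $M_{e_1}$ be the operator of multiplication by the function $e_1$ on $L^2(\mu)$, and let $P_{e_0}$ be the orthogonal projection onto $\mathrm{sp}\{e_0\}$ (acting on the one-dimensional summand $\mathrm{sp}\{e_0\}$). Then $U$ is unitarily equivalent to $$P_{e_0}\oplus\bigoplus_{k=0}^\infty M_{e_1}U .$$
   Context: $\mu_{1/4}$ is the unique Borel probability measure on $\mathbb{R}$ satisfying $\mu=\frac12\mu\circ\tau_+^{-1}+\frac12\mu\circ\tau_-^{-1}$ with $\tau_\pm(x)=\frac14(x\pm1)$. For $t\in\mathbb{R}$, $e_t(x)=e^{2\pi i t x}$ in $L^2(\mu)$. It is a known fact (to be taken as given) that both $\{e_\gamma:\gamma\in\Gamma\}$ and $\{e_{5\gamma}:\gamma\in\Gamma\}$ are orthonormal bases of $L^2(\mu_{1/4})$, so that $U$ is well defined and unitary. Each summand $M_{e_1}U$ acts on a copy of $L^2(\mu)$. *)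

theory Defs
  imports "HOL-Probability.Probability"
begin

text \<open>Complex inner product spaces are records with an explicit carrier; the inner product is
  linear in the first argument.\<close>

record 'a cips =
  carr :: "'a set"
  vadd :: "'a \<Rightarrow> 'a \<Rightarrow> 'a"
  vscale :: "complex \<Rightarrow> 'a \<Rightarrow> 'a"
  vinner :: "'a \<Rightarrow> 'a \<Rightarrow> complex"

definition vdiff :: "'a cips \<Rightarrow> 'a \<Rightarrow> 'a \<Rightarrow> 'a" where
  "vdiff H x y = vadd H x (vscale H (- 1) y)"

definition vnorm :: "'a cips \<Rightarrow> 'a \<Rightarrow> real" where
  "vnorm H x = sqrt (Re (vinner H x x))"

definition lin_subspace :: "'a cips \<Rightarrow> 'a set \<Rightarrow> bool" where
  "lin_subspace H S \<longleftrightarrow> S \<subseteq> carr H \<and> S \<noteq> {} \<and>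
     (\<forall>x\<in>S. \<forall>y\<in>S. vadd H x y \<in> S) \<and> (\<forall>c. \<forall>x\<in>S. vscale H c x \<in> S)"

definition lin_span :: "'a cips \<Rightarrow> 'a set \<Rightarrow> 'a set" where
  "lin_span H B = \<Inter> {S. lin_subspace H S \<and> B \<subseteq> S}"

definition restrict_space_to :: "'a cips \<Rightarrow> 'a set \<Rightarrow> 'a cips" where
  "restrict_space_to H S = H\<lparr>carr := S\<rparr>"

definition orth_proj :: "'a cips \<Rightarrow> 'a set \<Rightarrow> 'a \<Rightarrow> 'a" where
  "orth_proj H S x = (THE y. y \<in> S \<and> (\<forall>z\<in>S. vinner H (vdiff H x y) z = 0))"

text \<open>An orthonormal basis is a family (so distinct indices give orthogonal vectors) whose finite
  linear combinations are dense.\<close>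

definition orthonormal_basis :: "'a cips \<Rightarrow> 'i set \<Rightarrow> ('i \<Rightarrow> 'a) \<Rightarrow> bool" where
  "orthonormal_basis H I b \<longleftrightarrow>
     (\<forall>i\<in>I. b i \<in> carr H) \<and>
     (\<forall>i\<in>I. \<forall>j\<in>I. vinner H (b i) (b j) = (if i = j then 1 else 0)) \<and>
     (\<forall>x\<in>carr H. \<forall>\<epsilon>>0. \<exists>y\<in>lin_span H (b ` I). vnorm H (vdiff H x y) < \<epsilon>)"

definition unitary :: "'a cips \<Rightarrow> 'b cips \<Rightarrow> ('a \<Rightarrow> 'b) \<Rightarrow> bool" where
  "unitary H K W \<longleftrightarrow>
     bij_betw W (carr H) (carr K) \<and>
     (\<forall>x\<in>carr H. \<forall>y\<in>carr H. W (vadd H x y) = vadd K (W x) (W y)) \<and>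
     (\<forall>c. \<forall>x\<in>carr H. W (vscale H c x) = vscale K c (W x)) \<and>
     (\<forall>x\<in>carr H. \<forall>y\<in>carr H. vinner K (W x) (W y) = vinner H x y)"

definition unitarily_equivalent ::
    "'a cips \<Rightarrow> ('a \<Rightarrow> 'a) \<Rightarrow> 'b cips \<Rightarrow> ('b \<Rightarrow> 'b) \<Rightarrow> bool" where
  "unitarily_equivalent H T K S \<longleftrightarrow>
     (\<exists>W. unitary H K W \<and> (\<forall>x\<in>carr H. W (T x) = S (W x)))"

definition direct_sum :: "'a cips \<Rightarrow> 'b cips \<Rightarrow> ('a \<times> 'b) cips" where
  "direct_sum H K = \<lparr>
     carr = carr H \<times> carr K,
     vadd = (\<lambda>(x, y) (x', y'). (vadd H x x', vadd K y y')),
     vscale = (\<lambda>c (x, y). (vscale H c x, vscale K c y)),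
     vinner = (\<lambda>(x, y) (x', y'). vinner H x x' + vinner K y y') \<rparr>"

text \<open>The Hilbert space direct sum of a sequence of spaces: square-summable sequences.\<close>

definition hilbert_sum :: "(nat \<Rightarrow> 'a cips) \<Rightarrow> (nat \<Rightarrow> 'a) cips" where
  "hilbert_sum H = \<lparr>
     carr = {x. (\<forall>k. x k \<in> carr (H k)) \<and> summable (\<lambda>k. (vnorm (H k) (x k))\<^sup>2)},
     vadd = (\<lambda>x y k. vadd (H k) (x k) (y k)),
     vscale = (\<lambda>c x k. vscale (H k) c (x k)),
     vinner = (\<lambda>x y. \<Sum>k. vinner (H k) (x k) (y k)) \<rparr>"

definition op_direct_sum :: "('a \<Rightarrow> 'a) \<Rightarrow> ('b \<Rightarrow> 'b) \<Rightarrow> 'a \<times> 'b \<Rightarrow> 'a \<times> 'b" where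
  "op_direct_sum S T = map_prod S T"

definition op_hilbert_sum :: "(nat \<Rightarrow> 'a \<Rightarrow> 'a) \<Rightarrow> (nat \<Rightarrow> 'a) \<Rightarrow> (nat \<Rightarrow> 'a)" where
  "op_hilbert_sum T x = (\<lambda>k. T k (x k))"

text \<open>The elements of \<open>L2 M\<close> are almost-everywhere classes of square-integrable functions. The
  operations are computed on a chosen representative; the lemmas \<open>vadd_l2class\<close> to
  \<open>mult_op_l2class\<close> show that they do not depend on the choice.\<close>

definition sq_integrable :: "'x measure \<Rightarrow> ('x \<Rightarrow> complex) set" where
  "sq_integrable M = {f \<in> borel_measurable M. integrable M (\<lambda>x. (cmod (f x))\<^sup>2)}"

definition l2class :: "'x measure \<Rightarrow> ('x \<Rightarrow> complex) \<Rightarrow> ('x \<Rightarrow> complex) set" where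
  "l2class M f = {g \<in> sq_integrable M. AE x in M. g x = f x}"

definition l2rep :: "('x \<Rightarrow> complex) set \<Rightarrow> 'x \<Rightarrow> complex" where
  "l2rep A = (SOME f. f \<in> A)"

definition L2 :: "'x measure \<Rightarrow> ('x \<Rightarrow> complex) set cips" where
  "L2 M = \<lparr>
     carr = l2class M ` sq_integrable M,
     vadd = (\<lambda>A B. l2class M (\<lambda>x. l2rep A x + l2rep B x)),
     vscale = (\<lambda>c A. l2class M (\<lambda>x. c * l2rep A x)),
     vinner = (\<lambda>A B. \<integral>x. l2rep A x * cnj (l2rep B x) \<partial>M) \<rparr>"

definition mult_op ::
    "'x measure \<Rightarrow> ('x \<Rightarrow> complex) \<Rightarrow> ('x \<Rightarrow> complex) set \<Rightarrow> ('x \<Rightarrow> complex) set" where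
  "mult_op M \<phi> A = l2class M (\<lambda>x. \<phi> x * l2rep A x)"

lemma l2class_cong:
  assumes "AE x in M. f x = g x"
  shows "l2class M f = l2class M g"
proof -
  have "(AE x in M. h x = f x) \<longleftrightarrow> (AE x in M. h x = g x)" for h
  proof
    assume "AE x in M. h x = f x"
    then show "AE x in M. h x = g x" using assms by eventually_elim simp
  next
    assume "AE x in M. h x = g x"
    then show "AE x in M. h x = f x" using assms by eventually_elim simp
  qed
  then show ?thesis by (simp add: l2class_def)
qed

lemma l2class_eq_iff:
  assumes "f \<in> sq_integrable M"
  shows "l2class M f = l2class M g \<longleftrightarrow> (AE x in M. f x = g x)"
proof
  assume "l2class M f = l2class M g"
  moreover have "f \<in> l2class M f" using assms by (simp add: l2class_def)
  ultimately show "AE x in M. f x = g x" by (simp add: l2class_def)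
qed (rule l2class_cong)

lemma l2rep_l2class:
  assumes "f \<in> sq_integrable M"
  shows "l2rep (l2class M f) \<in> sq_integrable M" "AE x in M. l2rep (l2class M f) x = f x"
proof -
  have "f \<in> l2class M f" using assms by (simp add: l2class_def)
  then have "l2rep (l2class M f) \<in> l2class M f" unfolding l2rep_def by (rule someI[where P = "\<lambda>h. h \<in> l2class M f"])
  then show "l2rep (l2class M f) \<in> sq_integrable M" "AE x in M. l2rep (l2class M f) x = f x"
    by (auto simp: l2class_def)
qed

lemma vadd_l2class:
  assumes "f \<in> sq_integrable M" "g \<in> sq_integrable M"
  shows "vadd (L2 M) (l2class M f) (l2class M g) = l2class M (\<lambda>x. f x + g x)"
proof -
  have "AE x in M. l2rep (l2class M f) x + l2rep (l2class M g) x = f x + g x"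
    using l2rep_l2class(2)[OF assms(1)] l2rep_l2class(2)[OF assms(2)]
    by eventually_elim simp
  then show ?thesis unfolding L2_def cips.simps by (rule l2class_cong)
qed

lemma vscale_l2class:
  assumes "f \<in> sq_integrable M"
  shows "vscale (L2 M) c (l2class M f) = l2class M (\<lambda>x. c * f x)"
proof -
  have "AE x in M. c * l2rep (l2class M f) x = c * f x"
    using l2rep_l2class(2)[OF assms] by eventually_elim simp
  then show ?thesis unfolding L2_def cips.simps by (rule l2class_cong)
qed

lemma vinner_l2class:
  assumes "f \<in> sq_integrable M" "g \<in> sq_integrable M"
  shows "vinner (L2 M) (l2class M f) (l2class M g) = (\<integral>x. f x * cnj (g x) \<partial>M)"
proof -
  have [measurable]: "f \<in> borel_measurable M" "g \<in> borel_measurable M"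
    "l2rep (l2class M f) \<in> borel_measurable M" "l2rep (l2class M g) \<in> borel_measurable M"
    using assms l2rep_l2class(1)[OF assms(1)] l2rep_l2class(1)[OF assms(2)]
    by (auto simp: sq_integrable_def)
  have cnj_meas: "cnj \<in> borel_measurable borel"
    by (intro borel_measurable_continuous_onI continuous_intros)
  have "AE x in M. l2rep (l2class M f) x * cnj (l2rep (l2class M g) x) = f x * cnj (g x)"
    using l2rep_l2class(2)[OF assms(1)] l2rep_l2class(2)[OF assms(2)]
    by eventually_elim simp
  then show ?thesis
    unfolding L2_def cips.simps 
    by (intro integral_cong_AE borel_measurable_times
        measurable_compose[OF _ cnj_meas]) simp_all
qed

lemma mult_op_l2class:
  assumes "f \<in> sq_integrable M"
  shows "mult_op M \<phi> (l2class M f) = l2class M (\<lambda>x. \<phi> x * f x)"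
proof -
  have "AE x in M. \<phi> x * l2rep (l2class M f) x = \<phi> x * f x"
    using l2rep_l2class(2)[OF assms] by eventually_elim simp
  then show ?thesis unfolding mult_op_def by (rule l2class_cong)
qed

definition \<tau>_plus :: "real \<Rightarrow> real" where "\<tau>_plus x = (x + 1) / 4"

definition \<tau>_minus :: "real \<Rightarrow> real" where "\<tau>_minus x = (x - 1) / 4"

text \<open>The defining property of \<open>\<mu>\<^bsub>1/4\<^esub>\<close>; there is exactly one such measure, by Hutchinson's
  theorem.\<close>

definition is_mu_quarter :: "real measure \<Rightarrow> bool" where
  "is_mu_quarter \<mu> \<longleftrightarrow> prob_space \<mu> \<and> sets \<mu> = sets borel \<and>
     (\<forall>A\<in>sets borel. measure \<mu> A =
        1/2 * measure (distr \<mu> borel \<tau>_plus) A + 1/2 * measure (distr \<mu> borel \<tau>_minus) A)"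

definition Gam :: "real set" where
  "Gam = {\<Sum>i=0..m. a i * 4 ^ i | (m::nat) (a::nat \<Rightarrow> real). \<forall>i\<le>m. a i \<in> {0, 1}}"

definition ee :: "real \<Rightarrow> real \<Rightarrow> complex" where
  "ee t x = exp (2 * of_real pi * \<i> * of_real t * of_real x)"

abbreviation exp_class :: "real measure \<Rightarrow> real \<Rightarrow> (real \<Rightarrow> complex) set" where
  "exp_class \<mu> t \<equiv> l2class \<mu> (ee t)"

end

theory Submission
  imports Defs
begin

text \<open>Let \<open>S\<close> be composition with the expanding map that inverts \<open>\<tau>\<^sub>+\<close> and \<open>\<tau>\<^sub>-\<close> on the support of
  \<open>\<mu>\<close>. Since \<open>\<mu>\<close> is invariant under that map, \<open>S\<close> is an isometry, and \<open>S e\<^sub>t = e\<^sub>4\<^sub>t\<close> for every integer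
  \<open>t\<close>. The isometries \<open>V\<^sub>k f = S\<^sup>k (e\<^sub>1 \<cdot> S f)\<close> satisfy \<open>V\<^sub>k e\<^sub>\<gamma> = e\<^sub>\<delta>\<close> with \<open>\<delta> = 4\<^sup>k (1 + 4\<gamma>)\<close>, and every
  nonzero element of \<open>\<Gamma>\<close> has the form \<open>\<delta>\<close> for some \<open>k\<close> and \<open>\<gamma>\<close>. Hence \<open>L\<^sup>2(\<mu>)\<close> is the orthogonal sum of the
  constants and the ranges of the \<open>V\<^sub>k\<close>. Both \<open>U V\<^sub>k\<close> and \<open>V\<^sub>k M U\<close>, with \<open>M\<close> the multiplication by
  \<open>e\<^sub>1\<close>, send \<open>e\<^sub>\<gamma>\<close> to the exponential of frequency \<open>5 \<cdot> 4\<^sup>k (1 + 4\<gamma>) = 4\<^sup>k (1 + 4(1 + 5\<gamma>))\<close>, so \<open>U\<close>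
  acts as \<open>M U\<close> on each of these ranges and fixes the constants.\<close>

section \<open>Square-integrable functions\<close>

text \<open>Inner products and squared norms are taken of functions rather than of classes, so that
  composition with point maps can be computed pointwise. \<open>ip_l2rep\<close> and
  \<open>nsq_l2rep\<close> carry the values over to \<open>L2 M\<close>.\<close>

definition ip :: "'x measure \<Rightarrow> ('x \<Rightarrow> complex) \<Rightarrow> ('x \<Rightarrow> complex) \<Rightarrow> complex" where
  "ip M f g = (\<integral>x. f x * cnj (g x) \<partial>M)"

definition nsq :: "'x measure \<Rightarrow> ('x \<Rightarrow> complex) \<Rightarrow> real" where
  "nsq M f = (\<integral>x. (cmod (f x))\<^sup>2 \<partial>M)"

lemma sq_integrableD:
  assumes "f \<in> sq_integrable M"
  shows "f \<in> borel_measurable M" "integrable M (\<lambda>x. (cmod (f x))\<^sup>2)"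
  using assms by (auto simp: sq_integrable_def)

lemma borel_measurable_cnj [measurable (raw)]:
  assumes "f \<in> borel_measurable M"
  shows "(\<lambda>x. cnj (f x)) \<in> borel_measurable M"
  by (rule measurable_compose[OF assms]) (intro borel_measurable_continuous_onI continuous_intros)

lemma cmod_add_power2_le: "(cmod (a + b))\<^sup>2 \<le> 2 * (cmod a)\<^sup>2 + 2 * (cmod b)\<^sup>2"
proof -
  have "(cmod (a + b))\<^sup>2 \<le> (cmod a + cmod b)\<^sup>2"
    by (intro power_mono norm_triangle_ineq) auto
  also have "\<dots> \<le> 2 * (cmod a)\<^sup>2 + 2 * (cmod b)\<^sup>2"
    using sum_squares_bound[of "cmod a" "cmod b"] by (simp add: power2_sum)
  finally show ?thesis .
qed

lemma sq_integrable_add: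
  assumes "f \<in> sq_integrable M" "g \<in> sq_integrable M"
  shows "(\<lambda>x. f x + g x) \<in> sq_integrable M"
proof -
  note [measurable] = assms[THEN sq_integrableD(1)]
  have "integrable M (\<lambda>x. 2 * (cmod (f x))\<^sup>2 + 2 * (cmod (g x))\<^sup>2)"
    using assms[THEN sq_integrableD(2)] by simp
  then have "integrable M (\<lambda>x. (cmod (f x + g x))\<^sup>2)"
  proof (rule Bochner_Integration.integrable_bound)
    show "AE x in M. norm ((cmod (f x + g x))\<^sup>2) \<le> norm (2 * (cmod (f x))\<^sup>2 + 2 * (cmod (g x))\<^sup>2)"
      by (simp add: cmod_add_power2_le)
  qed measurable
  then show ?thesis by (simp add: sq_integrable_def)
qed

lemma sq_integrable_bounded_mult:
  assumes "f \<in> sq_integrable M" and [measurable]: "\<phi> \<in> borel_measurable M"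
    and "\<And>x. cmod (\<phi> x) \<le> C"
  shows "(\<lambda>x. \<phi> x * f x) \<in> sq_integrable M"
proof -
  note [measurable] = assms(1)[THEN sq_integrableD(1)]
  have "integrable M (\<lambda>x. C\<^sup>2 * (cmod (f x))\<^sup>2)"
    using assms(1)[THEN sq_integrableD(2)] by simp
  then have "integrable M (\<lambda>x. (cmod (\<phi> x * f x))\<^sup>2)"
    by (rule Bochner_Integration.integrable_bound)
      (auto simp: norm_mult power_mult_distrib intro!: mult_right_mono power_mono assms(3))
  then show ?thesis by (simp add: sq_integrable_def)
qed

lemma sq_integrable_scale:
  assumes "f \<in> sq_integrable M"
  shows "(\<lambda>x. c * f x) \<in> sq_integrable M"
  by (rule sq_integrable_bounded_mult[OF assms, where C="cmod c"]) auto

lemma sq_integrable_zero: "(\<lambda>x. 0) \<in> sq_integrable M"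
  by (simp add: sq_integrable_def)

lemma sq_integrable_diff:
  assumes "f \<in> sq_integrable M" "g \<in> sq_integrable M"
  shows "(\<lambda>x. f x - g x) \<in> sq_integrable M"
  using sq_integrable_add[OF assms(1) sq_integrable_scale[OF assms(2), of "-1"]] by simp

lemma sq_integrable_sum:
  assumes "\<And>i. i \<in> I \<Longrightarrow> f i \<in> sq_integrable M"
  shows "(\<lambda>x. \<Sum>i\<in>I. f i x) \<in> sq_integrable M"
  using assms
  by (induction I rule: infinite_finite_induct) (auto simp: sq_integrable_zero intro: sq_integrable_add)

lemma (in finite_measure) sq_integrable_const: "(\<lambda>x. c) \<in> sq_integrable M"
  by (simp add: sq_integrable_def)

section \<open>Algebra of the inner product and the squared norm\<close>

lemma integrable_ip:
  assumes "f \<in> sq_integrable M" "g \<in> sq_integrable M"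
  shows "integrable M (\<lambda>x. f x * cnj (g x))"
proof -
  note [measurable] = assms[THEN sq_integrableD(1)]
  have "integrable M (\<lambda>x. (cmod (f x))\<^sup>2 + (cmod (g x))\<^sup>2)"
    using assms[THEN sq_integrableD(2)] by simp
  then show ?thesis
  proof (rule Bochner_Integration.integrable_bound)
    have "cmod a * cmod b \<le> (cmod a)\<^sup>2 + (cmod b)\<^sup>2" for a b
      using sum_squares_bound[of "cmod a" "cmod b"] mult_nonneg_nonneg[of "cmod a" "cmod b"]
      by (simp add: mult.assoc del: mult_nonneg_nonneg)
    then show "AE x in M. norm (f x * cnj (g x)) \<le> norm ((cmod (f x))\<^sup>2 + (cmod (g x))\<^sup>2)"
      by (simp add: norm_mult)
  qed measurable
qed

lemma ip_cong_AE:
  assumes "AE x in M. f x = f' x" "AE x in M. g x = g' x"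
    "f \<in> sq_integrable M" "g \<in> sq_integrable M" "f' \<in> sq_integrable M" "g' \<in> sq_integrable M"
  shows "ip M f g = ip M f' g'"
proof -
  note [measurable] = assms(3-)[THEN sq_integrableD(1)]
  show ?thesis unfolding ip_def
    by (rule integral_cong_AE) (use assms(1,2) in auto)
qed

lemma ip_add_left:
  assumes "f \<in> sq_integrable M" "g \<in> sq_integrable M" "h \<in> sq_integrable M"
  shows "ip M (\<lambda>x. f x + g x) h = ip M f h + ip M g h"
  using integrable_ip[OF assms(1,3)] integrable_ip[OF assms(2,3)]
  by (simp add: ip_def algebra_simps)

lemma ip_diff_left:
  assumes "f \<in> sq_integrable M" "g \<in> sq_integrable M" "h \<in> sq_integrable M"
  shows "ip M (\<lambda>x. f x - g x) h = ip M f h - ip M g h"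
  using integrable_ip[OF assms(1,3)] integrable_ip[OF assms(2,3)]
  by (simp add: ip_def algebra_simps)

lemma ip_scale_left: "ip M (\<lambda>x. c * f x) h = c * ip M f h"
  by (simp add: ip_def mult.assoc)

lemma ip_commute: "ip M g f = cnj (ip M f g)"
  using Bochner_Integration.integral_cnj[of M "\<lambda>x. f x * cnj (g x)"] by (simp add: ip_def mult.commute del: Bochner_Integration.integral_cnj)

lemma ip_sum_left:
  assumes "\<And>i. i \<in> I \<Longrightarrow> f i \<in> sq_integrable M" "h \<in> sq_integrable M"
  shows "ip M (\<lambda>x. \<Sum>i\<in>I. f i x) h = (\<Sum>i\<in>I. ip M (f i) h)"
  using integrable_ip[OF assms(1) assms(2)]
  by (simp add: ip_def sum_distrib_right)

lemma ip_sum_right: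
  assumes "\<And>i. i \<in> I \<Longrightarrow> f i \<in> sq_integrable M" "h \<in> sq_integrable M"
  shows "ip M h (\<lambda>x. \<Sum>i\<in>I. f i x) = (\<Sum>i\<in>I. ip M h (f i))"
  unfolding ip_commute[of M h] by (subst ip_sum_left) (use assms in auto)

lemma ip_self: "ip M f f = of_real (nsq M f)"
  by (simp add: ip_def nsq_def complex_norm_square[symmetric] flip: integral_complex_of_real)

lemma nsq_nonneg: "nsq M f \<ge> 0"
  by (simp add: nsq_def)

lemma nsq_eq_0_iff:
  assumes "f \<in> sq_integrable M"
  shows "nsq M f = 0 \<longleftrightarrow> (AE x in M. f x = 0)"
  unfolding nsq_def using assms[THEN sq_integrableD(2)] by (subst integral_nonneg_eq_0_iff_AE) auto

lemma nsq_cong_AE: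
  assumes "AE x in M. f x = g x" "f \<in> sq_integrable M" "g \<in> sq_integrable M"
  shows "nsq M f = nsq M g"
  using ip_cong_AE[OF assms(1,1) assms(2,2) assms(3,3)] by (simp add: ip_self)

lemma nsq_add_le:
  assumes "f \<in> sq_integrable M" "g \<in> sq_integrable M"
  shows "nsq M (\<lambda>x. f x + g x) \<le> 2 * nsq M f + 2 * nsq M g"
proof -
  have "nsq M (\<lambda>x. f x + g x) \<le> (\<integral>x. 2 * (cmod (f x))\<^sup>2 + 2 * (cmod (g x))\<^sup>2 \<partial>M)"
    unfolding nsq_def
    by (rule integral_mono[OF sq_integrableD(2)[OF sq_integrable_add[OF assms]] _ cmod_add_power2_le])
       (use assms[THEN sq_integrableD(2)] in simp)
  also have "\<dots> = 2 * nsq M f + 2 * nsq M g"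
    unfolding nsq_def using assms[THEN sq_integrableD(2)] by simp
  finally show ?thesis .
qed

lemma nsq_diff_commute: "nsq M (\<lambda>x. f x - g x) = nsq M (\<lambda>x. g x - f x)"
  by (simp add: nsq_def norm_minus_commute)

lemma nsq_diff_le:
  assumes "f \<in> sq_integrable M" "g \<in> sq_integrable M" "h \<in> sq_integrable M"
  shows "nsq M (\<lambda>x. f x - h x) \<le> 2 * nsq M (\<lambda>x. f x - g x) + 2 * nsq M (\<lambda>x. g x - h x)"
  using nsq_add_le[OF sq_integrable_diff[OF assms(1,2)] sq_integrable_diff[OF assms(2,3)]] by simp

text \<open>If \<open>g\<close> is not null, put \<open>a = ip M f g\<close> and
  \<open>b = nsq M g\<close>. Then \<open>h = b f - a g\<close> is orthogonal to \<open>g\<close>,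
  and its squared norm works out to \<open>b (b nsq M f - |a|^2)\<close>, which must be
  nonnegative.\<close>

lemma cauchy_schwarz:
  assumes "f \<in> sq_integrable M" "g \<in> sq_integrable M"
  shows "(cmod (ip M f g))\<^sup>2 \<le> nsq M f * nsq M g"
proof (cases "nsq M g = 0")
  case True
  then have "AE x in M. g x = 0" using assms nsq_eq_0_iff by blast
  then have "ip M f g = ip M f (\<lambda>x. 0)"
    by (intro ip_cong_AE) (auto simp: assms sq_integrable_zero)
  then show ?thesis using True by (simp add: ip_def)
next
  case False
  define a where "a = ip M f g"
  define b where "b = nsq M g"
  have b: "b > 0" using False nsq_nonneg[of M g] by (simp add: b_def)
  define h where "h = (\<lambda>x. of_real b * f x - a * g x)"
  have sc: "(\<lambda>x. of_real b * f x) \<in> sq_integrable M" "(\<lambda>x. a * g x) \<in> sq_integrable M"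
    using assms by (auto intro: sq_integrable_scale)
  have h: "h \<in> sq_integrable M" unfolding h_def by (rule sq_integrable_diff[OF sc])
  have hg: "ip M h g = 0"
    unfolding h_def ip_diff_left[OF sc assms(2)] ip_scale_left by (simp add: a_def b_def ip_self)
  have "of_real (nsq M h) = of_real b * ip M f h - a * ip M g h"
    unfolding ip_self[symmetric]
    by (subst (1) h_def) (simp add: ip_diff_left[OF sc h] ip_scale_left)
  also have "ip M g h = 0" using hg ip_commute[of M g h] by simp
  also have "ip M f h = cnj (of_real b * ip M f f - a * ip M g f)"
    unfolding ip_commute[of M f h] unfolding h_def ip_diff_left[OF sc assms(1)] ip_scale_left by simp
  also have "\<dots> = of_real b * of_real (nsq M f) - of_real ((cmod a)\<^sup>2)"
    unfolding complex_norm_square ip_commute[of M g f] by (simp add: ip_self a_def mult.commute)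
  finally have "complex_of_real (nsq M h) = of_real (b * (b * nsq M f - (cmod a)\<^sup>2))" by simp
  then have "nsq M h = b * (b * nsq M f - (cmod a)\<^sup>2)" using of_real_eq_iff by blast
  then have "b * (b * nsq M f - (cmod a)\<^sup>2) \<ge> 0" using nsq_nonneg[of M h] by simp
  then show ?thesis using b by (simp add: zero_le_mult_iff a_def b_def mult.commute)
qed

lemma tendsto_ip_left:
  assumes "\<And>n. s n \<in> sq_integrable M" "z \<in> sq_integrable M" "w \<in> sq_integrable M"
    and lim: "(\<lambda>n. nsq M (\<lambda>x. s n x - z x)) \<longlonglongrightarrow> 0"
  shows "(\<lambda>n. ip M (s n) w) \<longlonglongrightarrow> ip M z w"
proof -
  have null: "(\<lambda>n. sqrt (nsq M (\<lambda>x. s n x - z x) * nsq M w)) \<longlonglongrightarrow> 0"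
    using tendsto_real_sqrt[OF tendsto_mult[OF lim tendsto_const[of "nsq M w"]]] by simp
  have "(\<lambda>n. ip M (s n) w - ip M z w) \<longlonglongrightarrow> 0"
  proof (rule Lim_null_comparison[OF _ null])
    have "cmod (ip M (s n) w - ip M z w) \<le> sqrt (nsq M (\<lambda>x. s n x - z x) * nsq M w)" for n
      using cauchy_schwarz[OF sq_integrable_diff[OF assms(1,2)] assms(3), of n]
      by (auto simp: ip_diff_left assms intro: real_le_rsqrt)
    then show "\<forall>\<^sub>F n in sequentially. cmod (ip M (s n) w - ip M z w)
        \<le> sqrt (nsq M (\<lambda>x. s n x - z x) * nsq M w)"
      by simp
  qed
  then show ?thesis by (simp add: Lim_null[symmetric])
qed

text \<open>On a finite measure space the bound t \<le> (2^k t^2 + 2^(-k)) / 2 turns decay 4^(-k) of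
  the squared norms into decay 2^(-k) of the integrals of \<open>cmod (a k x)\<close>. The sum of
  these functions then has a finite integral, so it is finite almost everywhere.\<close>

lemma (in finite_measure) AE_summable_of_nsq:
  assumes a: "\<And>k. a k \<in> sq_integrable M" and le: "\<And>k. nsq M (a k) \<le> (1/4) ^ k"
  shows "AE x in M. summable (\<lambda>k. cmod (a k x))"
proof -
  note [measurable] = a[THEN sq_integrableD(1)]
  define c where "c = (1 + measure M (space M)) / 2"
  have i: "integrable M (\<lambda>x. cmod (a k x))" for k
    using square_integrable_imp_integrable[of "\<lambda>x. cmod (a k x)"] a[THEN sq_integrableD(2), of k] by simp
  have le1: "(\<integral>x. cmod (a k x) \<partial>M) \<le> c * (1/2) ^ k" for k
  proof -
    have "t \<le> (2 ^ k * t\<^sup>2 + (1/2) ^ k) / 2" for t :: real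
    proof -
      have "0 \<le> (2 ^ k * t - 1)\<^sup>2 * (1/2)^k" by simp
      also have "\<dots> = 2 ^ k * t\<^sup>2 + (1/2) ^ k - 2 * t"
        by (simp add: power2_eq_square field_simps)
      finally show ?thesis by simp
    qed
    then have "(\<integral>x. cmod (a k x) \<partial>M) \<le> (\<integral>x. (2 ^ k * (cmod (a k x))\<^sup>2 + (1/2) ^ k) / 2 \<partial>M)"
      using a[THEN sq_integrableD(2), of k] by (intro integral_mono i) auto
    also have "\<dots> = (2 ^ k * nsq M (a k) + (1/2) ^ k * measure M (space M)) / 2"
      using a[THEN sq_integrableD(2), of k] by (simp add: nsq_def)
    also have "\<dots> \<le> (2 ^ k * (1/4) ^ k + (1/2) ^ k * measure M (space M)) / 2"
      using le[of k] by simp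
    also have "2 ^ k * (1/4) ^ k = (1/2 :: real) ^ k" by (simp add: power_mult_distrib[symmetric])
    finally show ?thesis by (simp add: c_def algebra_simps)
  qed
  have "(\<integral>\<^sup>+x. (\<Sum>k. ennreal (cmod (a k x))) \<partial>M) = (\<Sum>k. \<integral>\<^sup>+x. ennreal (cmod (a k x)) \<partial>M)"
    by (rule nn_integral_suminf) measurable
  also have "\<dots> = (\<Sum>k. ennreal (\<integral>x. cmod (a k x) \<partial>M))"
    by (intro suminf_cong nn_integral_eq_integral i) auto
  also have "\<dots> < \<infinity>"
  proof -
    have "summable (\<lambda>k. c * (1/2) ^ k)" by (intro summable_mult summable_geometric) auto
    then have "summable (\<lambda>k. \<integral>x. cmod (a k x) \<partial>M)"
      by (rule summable_comparison_test'[where N=0]) (use le1 in auto)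
    then show ?thesis by (subst suminf_ennreal2) auto
  qed
  finally have "AE x in M. (\<Sum>k. ennreal (cmod (a k x))) \<noteq> \<infinity>"
    by (intro nn_integral_PInf_AE) auto
  then show ?thesis
    by eventually_elim (rule summable_suminf_not_top, auto)
qed

text \<open>Riesz-Fischer: a subsequence whose consecutive squared distances are at most 4^(-k)
  converges almost everywhere, and Fatou's lemma shows that its pointwise limit is also the limit in
  norm.\<close>

lemma (in finite_measure) L2_complete:
  assumes s: "\<And>n. s n \<in> sq_integrable M"
    and cau: "\<And>e. e > 0 \<Longrightarrow> \<exists>N. \<forall>m\<ge>N. \<forall>n\<ge>N. nsq M (\<lambda>x. s m x - s n x) \<le> e"
  shows "\<exists>z\<in>sq_integrable M. (\<lambda>n. nsq M (\<lambda>x. s n x - z x)) \<longlonglongrightarrow> 0"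
proof -
  note [measurable] = s[THEN sq_integrableD(1)]
  have "\<exists>N. \<forall>k. \<forall>m\<ge>N k. \<forall>n\<ge>N k. nsq M (\<lambda>x. s m x - s n x) \<le> (1/4) ^ k"
    by (intro choice allI cau) auto
  then obtain N where N: "\<And>k m n. m \<ge> N k \<Longrightarrow> n \<ge> N k \<Longrightarrow> nsq M (\<lambda>x. s m x - s n x) \<le> (1/4) ^ k"
    by blast
  \<comment> \<open>The sum puts both \<open>R k\<close> and \<open>R (Suc k)\<close> above
    \<open>N k\<close>, as needed to compare consecutive terms; the summand \<open>k\<close> makes
    the indices tend to infinity.\<close>
  define R where "R k = (\<Sum>i\<le>k. N i) + k" for k
  have RN: "N k \<le> R k" "N k \<le> R (Suc k)" "k \<le> R k" for k
  proof -
    have "N j \<le> (\<Sum>i\<le>l. N i)" if "j \<le> l" for j l by (rule member_le_sum) (use that in auto)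
    from this[of k k] this[of k "Suc k"] show "N k \<le> R k" "N k \<le> R (Suc k)" "k \<le> R k"
      unfolding R_def by linarith+
  qed
  have "AE x in M. summable (\<lambda>k. cmod (s (R (Suc k)) x - s (R k) x))"
    by (intro AE_summable_of_nsq sq_integrable_diff s N RN)
  then have conv: "AE x in M. convergent (\<lambda>k. s (R k) x)"
  proof eventually_elim
    case (elim x)
    then have "summable (\<lambda>k. s (R (Suc k)) x - s (R k) x)" by (rule summable_norm_cancel)
    then have "convergent (\<lambda>n. (\<Sum>k<n. s (R (Suc k)) x - s (R k) x))"
      by (simp add: summable_iff_convergent)
    then have "convergent (\<lambda>n. s (R n) x - s (R 0) x)"
      by (simp only: sum_lessThan_telescope[of "\<lambda>k. s (R k) x"])
    then show ?case by (simp add: convergent_diff_const_right_iff)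
  qed
  \<comment> \<open>Where the subsequence diverges, \<open>lim\<close> gives an unspecified value;
    by \<open>conv\<close> this happens only on a null set.\<close>
  define z where "z x = lim (\<lambda>k. s (R k) x)" for x
  have [measurable]: "z \<in> borel_measurable M" unfolding z_def by measurable
  \<comment> \<open>Fatou's lemma along the subsequence: a bound on the distance from
    \<open>s m\<close> to all late terms passes to the distance from \<open>s m\<close> to
    \<open>z\<close>.\<close>
  have bound: "(\<integral>\<^sup>+x. ennreal ((cmod (s m x - z x))\<^sup>2) \<partial>M) \<le> ennreal e"
    if m: "\<And>n. n \<ge> K \<Longrightarrow> nsq M (\<lambda>x. s m x - s n x) \<le> e" for m K e
  proof -
    have "(\<integral>\<^sup>+x. ennreal ((cmod (s m x - z x))\<^sup>2) \<partial>M)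
        = (\<integral>\<^sup>+x. liminf (\<lambda>k. ennreal ((cmod (s m x - s (R k) x))\<^sup>2)) \<partial>M)"
    proof (rule nn_integral_cong_AE)
      show "AE x in M. ennreal ((cmod (s m x - z x))\<^sup>2)
          = liminf (\<lambda>k. ennreal ((cmod (s m x - s (R k) x))\<^sup>2))"
        using conv
      proof eventually_elim
        case (elim x)
        then have "(\<lambda>k. s (R k) x) \<longlonglongrightarrow> z x" by (simp add: z_def convergent_LIMSEQ_iff)
        then have "(\<lambda>k. ennreal ((cmod (s m x - s (R k) x))\<^sup>2)) \<longlonglongrightarrow> ennreal ((cmod (s m x - z x))\<^sup>2)"
          by (intro tendsto_intros)
        from lim_imp_Liminf[OF sequentially_bot this] show ?case by (rule sym)
      qed
    qed
    also have "\<dots> \<le> liminf (\<lambda>k. \<integral>\<^sup>+x. ennreal ((cmod (s m x - s (R k) x))\<^sup>2) \<partial>M)"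
      by (rule nn_integral_liminf) measurable
    also have "\<dots> = liminf (\<lambda>k. ennreal (nsq M (\<lambda>x. s m x - s (R k) x)))"
      unfolding nsq_def
      by (intro arg_cong[where f=liminf] ext nn_integral_eq_integral
          sq_integrableD(2) sq_integrable_diff s) auto
    also have "\<dots> \<le> ennreal e"
    proof (rule Liminf_le)
      show "\<forall>\<^sub>F k in sequentially. ennreal (nsq M (\<lambda>x. s m x - s (R k) x)) \<le> ennreal e"
        using eventually_ge_at_top[of K]
        by eventually_elim (intro ennreal_leI m, use RN(3) le_trans in blast)
    qed simp
    finally show ?thesis .
  qed
  \<comment> \<open>The case \<open>k = 0\<close> of \<open>N\<close> bounds the squared distance
    from \<open>s (N 0)\<close> to \<open>z\<close> by 1. Hence the difference, and with it
    \<open>z\<close>, is square-integrable.\<close>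
  have "integrable M (\<lambda>x. (cmod (s (N 0) x - z x))\<^sup>2)"
  proof (rule integrableI_bounded)
    have "(\<integral>\<^sup>+x. ennreal ((cmod (s (N 0) x - z x))\<^sup>2) \<partial>M) \<le> ennreal 1"
      by (rule bound[where K="N 0"]) (use N[of 0 "N 0"] in auto)
    then show "(\<integral>\<^sup>+x. ennreal (norm ((cmod (s (N 0) x - z x))\<^sup>2)) \<partial>M) < \<infinity>"
      by (auto intro: le_less_trans)
  qed measurable
  then have "(\<lambda>x. s (N 0) x - z x) \<in> sq_integrable M" by (simp add: sq_integrable_def)
  from sq_integrable_diff[OF s[of "N 0"] this] have z: "z \<in> sq_integrable M" by simp
  have "(\<lambda>n. nsq M (\<lambda>x. s n x - z x)) \<longlonglongrightarrow> 0"
  proof (rule LIMSEQ_I)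
    fix e :: real assume e: "0 < e"
    obtain K where K: "\<forall>m\<ge>K. \<forall>n\<ge>K. nsq M (\<lambda>x. s m x - s n x) \<le> e/2" using cau[of "e/2"] e by auto
    show "\<exists>no. \<forall>n\<ge>no. norm (nsq M (\<lambda>x. s n x - z x) - 0) < e"
    proof (intro exI[of _ K] allI impI)
      fix n assume n: "K \<le> n"
      have "ennreal (nsq M (\<lambda>x. s n x - z x)) = (\<integral>\<^sup>+x. ennreal ((cmod (s n x - z x))\<^sup>2) \<partial>M)"
        unfolding nsq_def
        by (intro nn_integral_eq_integral[symmetric] sq_integrableD(2) sq_integrable_diff s z) auto
      also have "\<dots> \<le> ennreal (e/2)" by (rule bound[of K]) (use K n in auto)
      finally show "norm (nsq M (\<lambda>x. s n x - z x) - 0) < e" using e nsq_nonneg[of M "\<lambda>x. s n x - z x"] by simp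
    qed
  qed
  with z show ?thesis by blast
qed

section \<open>Passage between functions and their almost-everywhere classes\<close>

lemma carr_L2: "carr (L2 M) = l2class M ` sq_integrable M"
  by (simp add: L2_def)

lemma l2class_in_carr: "f \<in> sq_integrable M \<Longrightarrow> l2class M f \<in> carr (L2 M)"
  by (simp add: carr_L2)

lemma l2rep_sq:
  assumes "A \<in> carr (L2 M)"
  shows "l2rep A \<in> sq_integrable M" "l2class M (l2rep A) = A"
proof -
  obtain f where f: "f \<in> sq_integrable M" "A = l2class M f" using assms by (auto simp: carr_L2)
  show "l2rep A \<in> sq_integrable M" unfolding f(2) by (rule l2rep_l2class[OF f(1)])
  show "l2class M (l2rep A) = A"
    using l2class_cong[OF l2rep_l2class(2)[OF f(1)]] by (simp add: f(2))
qed

lemma vinner_L2: "vinner (L2 M) A B = ip M (l2rep A) (l2rep B)"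
  by (simp add: L2_def ip_def)

lemma vnorm_L2: "(vnorm (L2 M) A)\<^sup>2 = nsq M (l2rep A)"
  by (simp add: vnorm_def vinner_L2 ip_self nsq_nonneg)

lemma vdiff_l2class:
  assumes "f \<in> sq_integrable M" "g \<in> sq_integrable M"
  shows "vdiff (L2 M) (l2class M f) (l2class M g) = l2class M (\<lambda>x. f x - g x)"
  unfolding vdiff_def vscale_l2class[OF assms(2)]
  by (simp add: vadd_l2class assms(1) sq_integrable_scale[OF assms(2), of "- 1", simplified])

lemma ip_l2rep:
  assumes "f \<in> sq_integrable M" "g \<in> sq_integrable M"
  shows "ip M (l2rep (l2class M f)) (l2rep (l2class M g)) = ip M f g"
  by (intro ip_cong_AE l2rep_l2class assms)

lemma nsq_l2rep:
  assumes "f \<in> sq_integrable M"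
  shows "nsq M (l2rep (l2class M f)) = nsq M f"
  by (intro nsq_cong_AE l2rep_l2class assms)

text \<open>Density of the span of \<open>b\<close>, as an induction principle for functions.\<close>

lemma orthonormal_basis_induct [consumes 4, case_names basis cong add scale closed]:
  assumes onb: "orthonormal_basis (L2 M) I (\<lambda>i. l2class M (b i))"
    and I: "I \<noteq> {}"
    and b: "\<And>i. i \<in> I \<Longrightarrow> b i \<in> sq_integrable M"
    and f: "f \<in> sq_integrable M"
    and basis: "\<And>i. i \<in> I \<Longrightarrow> P (b i)"
    and cong: "\<And>f g. f \<in> sq_integrable M \<Longrightarrow> g \<in> sq_integrable M \<Longrightarrow> AE x in M. f x = g x \<Longrightarrow> P f \<Longrightarrow> P g"
    and add: "\<And>f g. f \<in> sq_integrable M \<Longrightarrow> g \<in> sq_integrable M \<Longrightarrow> P f \<Longrightarrow> P g \<Longrightarrow> P (\<lambda>x. f x + g x)"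
    and scale: "\<And>f c. f \<in> sq_integrable M \<Longrightarrow> P f \<Longrightarrow> P (\<lambda>x. c * f x)"
    and closed: "\<And>f. f \<in> sq_integrable M \<Longrightarrow>
        (\<And>e. e > 0 \<Longrightarrow> \<exists>g\<in>sq_integrable M. P g \<and> nsq M (\<lambda>x. f x - g x) < e) \<Longrightarrow> P f"
  shows "P f"
proof (rule closed[OF f])
  \<comment> \<open>By \<open>cong\<close> it does not matter which representative is tested. So
    \<open>S\<close> is a linear subspace that contains the basis, hence contains the span, and
    \<open>closed\<close> then reaches its limits.\<close>
  define S where "S = {A \<in> carr (L2 M). P (l2rep A)}"
  have class_S: "l2class M g \<in> S" if "g \<in> sq_integrable M" "P g" for g
  proof -
    have "AE x in M. g x = l2rep (l2class M g) x" using l2rep_l2class(2)[OF that(1)] by eventually_elim simp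
    from cong[OF that(1) l2rep_l2class(1)[OF that(1)] this that(2)] show ?thesis
      by (simp add: S_def l2class_in_carr that)
  qed
  have S: "l2rep A \<in> sq_integrable M" "P (l2rep A)" "l2class M (l2rep A) = A" if "A \<in> S" for A
    using that l2rep_sq[of A M] by (simp_all add: S_def)
  fix e :: real assume e: "e > 0"
  have span: "lin_span (L2 M) ((\<lambda>i. l2class M (b i)) ` I) \<subseteq> S"
  proof -
    have "lin_subspace (L2 M) S"
      unfolding lin_subspace_def
    proof (intro conjI ballI allI)
      show "S \<subseteq> carr (L2 M)" by (auto simp: S_def)
      show "S \<noteq> {}" using class_S[OF b basis] I by blast
      show "vadd (L2 M) A B \<in> S" if "A \<in> S" "B \<in> S" for A B
        using class_S[OF sq_integrable_add add] S[OF that(1)] S[OF that(2)] vadd_l2class[of "l2rep A" M "l2rep B"]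
        by simp
      show "vscale (L2 M) c A \<in> S" if "A \<in> S" for A c
        using class_S[OF sq_integrable_scale scale] S[OF that] vscale_l2class[of "l2rep A" M c]
        by simp
    qed
    moreover have "(\<lambda>i. l2class M (b i)) ` I \<subseteq> S" using class_S[OF b basis] by blast
    ultimately show ?thesis unfolding lin_span_def by blast
  qed
  have "\<exists>A\<in>lin_span (L2 M) ((\<lambda>i. l2class M (b i)) ` I). vnorm (L2 M) (vdiff (L2 M) (l2class M f) A) < sqrt e"
    using onb e l2class_in_carr[OF f] by (auto simp: orthonormal_basis_def)
  then obtain A where A: "A \<in> S" "vnorm (L2 M) (vdiff (L2 M) (l2class M f) A) < sqrt e" using span by blast
  note SA = S[OF A(1)]
  have "vdiff (L2 M) (l2class M f) A = l2class M (\<lambda>x. f x - l2rep A x)"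
    using vdiff_l2class[OF f SA(1)] SA(3) by simp
  then have "nsq M (\<lambda>x. f x - l2rep A x) = (vnorm (L2 M) (vdiff (L2 M) (l2class M f) A))\<^sup>2"
    by (simp add: vnorm_L2 nsq_l2rep sq_integrable_diff f SA)
  also have "\<dots> < (sqrt e)\<^sup>2"
    using A(2) by (intro power_strict_mono) (auto simp: vnorm_def vinner_L2 ip_self nsq_nonneg)
  finally have "nsq M (\<lambda>x. f x - l2rep A x) < e" using e by simp
  then show "\<exists>g\<in>sq_integrable M. P g \<and> nsq M (\<lambda>x. f x - g x) < e" using SA by blast
qed

lemma lin_span_const:
  assumes "prob_space M"
  shows "lin_span (L2 M) {l2class M (\<lambda>x. 1)} = range (\<lambda>c. l2class M (\<lambda>x. c))"
proof
  interpret prob_space M by fact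
  show "lin_span (L2 M) {l2class M (\<lambda>x. 1)} \<subseteq> range (\<lambda>c. l2class M (\<lambda>x. c))"
  proof -
    have "lin_subspace (L2 M) (range (\<lambda>c. l2class M (\<lambda>x. c)))"
      by (auto simp: lin_subspace_def vadd_l2class vscale_l2class sq_integrable_const
          intro!: l2class_in_carr)
    then show ?thesis unfolding lin_span_def by blast
  qed
  show "range (\<lambda>c. l2class M (\<lambda>x. c)) \<subseteq> lin_span (L2 M) {l2class M (\<lambda>x. 1)}"
  proof (clarsimp simp: lin_span_def)
    fix c S assume "lin_subspace (L2 M) S" "l2class M (\<lambda>x. 1) \<in> S"
    then have "vscale (L2 M) c (l2class M (\<lambda>x. 1)) \<in> S" by (simp add: lin_subspace_def)
    then show "l2class M (\<lambda>x. c) \<in> S" by (simp add: vscale_l2class sq_integrable_const)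
  qed
qed

text \<open>\<open>orth_proj\<close> is a definite description, so uniqueness has to be shown too:
  for a competitor \<open>B\<close> the difference of \<open>A\<close> and \<open>B\<close> lies in
  \<open>S\<close> and is orthogonal to \<open>S\<close>, hence to itself.\<close>

lemma orth_proj_of_mem:
  assumes S: "S \<subseteq> carr (L2 M)" "lin_subspace (L2 M) S" and A: "A \<in> S"
  shows "orth_proj (L2 M) S A = A"
  unfolding orth_proj_def
proof (rule the_equality)
  have carr: "B \<in> carr (L2 M)" if "B \<in> S" for B using S that by blast
  note rep = l2rep_sq[OF carr]
  have diff: "vdiff (L2 M) A B = l2class M (\<lambda>x. l2rep A x - l2rep B x)" if "B \<in> S" for B
    using vdiff_l2class[OF rep(1)[OF A] rep(1)[OF that]] by (simp add: rep A that)
  have diff_S: "vdiff (L2 M) A B \<in> S" if "B \<in> S" for B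
    using S(2) A that by (simp add: vdiff_def lin_subspace_def)
  have vin: "vinner (L2 M) (vdiff (L2 M) A B) C = ip M (\<lambda>x. l2rep A x - l2rep B x) (l2rep C)"
    if "B \<in> S" "C \<in> S" for B C
  proof -
    have "AE x in M. l2rep (vdiff (L2 M) A B) x = l2rep A x - l2rep B x"
      unfolding diff[OF that(1)]
      by (intro l2rep_l2class sq_integrable_diff rep A that)
    then show ?thesis
      unfolding vinner_L2 by (intro ip_cong_AE) (auto intro: sq_integrable_diff rep(1) A that diff_S)
  qed
  show "A \<in> S \<and> (\<forall>z\<in>S. vinner (L2 M) (vdiff (L2 M) A A) z = 0)"
    using A by (auto simp: vin[OF A] ip_def)
  fix B assume B: "B \<in> S \<and> (\<forall>z\<in>S. vinner (L2 M) (vdiff (L2 M) A B) z = 0)"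
  let ?d = "vdiff (L2 M) A B"
  have "ip M (l2rep ?d) (l2rep ?d) = 0" using B diff_S by (simp add: vinner_L2)
  then have "AE x in M. l2rep ?d x = 0"
    using nsq_eq_0_iff[OF rep(1)[OF diff_S]] B by (simp add: ip_self)
  moreover have "AE x in M. l2rep ?d x = l2rep A x - l2rep B x"
    unfolding diff[OF conjunct1[OF B]]
    by (intro l2rep_l2class sq_integrable_diff rep A conjunct1[OF B])
  ultimately have "AE x in M. l2rep B x = l2rep A x" by eventually_elim simp
  from l2class_cong[OF this] show "B = A" using rep(2)[of A] rep(2)[of B] A B by simp
qed

section \<open>Exponentials and the set of frequencies\<close>

lemma ee_measurable [measurable]: "ee t \<in> borel_measurable borel"
  unfolding ee_def by measurable

lemma norm_ee [simp]: "cmod (ee t x) = 1"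
proof -
  have "ee t x = exp (\<i> * of_real (2 * pi * t * x))" by (simp add: ee_def mult_ac)
  then show ?thesis by (simp only: norm_exp_i_times)
qed

lemma ee_0: "ee 0 = (\<lambda>x. 1)"
  by (rule ext) (simp add: ee_def)

lemma ee_add: "ee (s + t) x = ee s x * ee t x"
  by (simp add: ee_def exp_add[symmetric] algebra_simps)

lemma ee_mult_cnj [simp]: "ee t x * cnj (ee t x) = 1" "cnj (ee t x) * ee t x = 1"
  using complex_norm_square[of "ee t x"] by (simp_all add: mult.commute)

lemma ee_int: "t \<in> \<int> \<Longrightarrow> y \<in> \<int> \<Longrightarrow> ee t y = 1"
proof -
  assume "t \<in> \<int>" "y \<in> \<int>"
  then obtain n :: int where n: "t * y = of_int n" by (metis Ints_cases Ints_mult)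
  have "ee t y = exp (2 * of_real pi * \<i> * of_real (t * y))" by (simp add: ee_def mult_ac)
  then show ?thesis unfolding n by (simp add: exp_eq_1)
qed

text \<open>The points \<open>\<tau>_plus x\<close> and \<open>\<tau>_minus x\<close> differ by 1/2,
  which contributes the factor exp(i pi) = -1.\<close>

lemma ee_1_tau: "ee 1 (\<tau>_minus x) = - ee 1 (\<tau>_plus x)"
proof -
  have "ee 1 (\<tau>_plus x) = exp (2 * of_real pi * \<i> * of_real (\<tau>_minus x) + \<i> * of_real pi)"
    by (simp add: ee_def \<tau>_plus_def \<tau>_minus_def field_simps)
  also have "\<dots> = - ee 1 (\<tau>_minus x)" by (simp add: exp_add ee_def)
  finally show ?thesis by simp
qed

lemma tau_measurable [measurable]: "\<tau>_plus \<in> borel_measurable borel" "\<tau>_minus \<in> borel_measurable borel"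
  unfolding \<tau>_plus_def[abs_def] \<tau>_minus_def[abs_def] by measurable

text \<open>On the support of \<open>\<mu>\<close>, which lies in \<open>[-1/3, 1/3]\<close>, this map inverts both contractions.\<close>

definition expand :: "real \<Rightarrow> real" where
  "expand x = (if x > 0 then 4 * x - 1 else 4 * x + 1)"

lemma expand_measurable [measurable]: "expand \<in> borel_measurable borel"
  unfolding expand_def[abs_def] by measurable

text \<open>The hypotheses make \<open>\<tau>_plus x\<close> positive and
  \<open>\<tau>_minus x\<close> negative, so the test in \<open>expand\<close> selects the matching
  inverse.\<close>

lemma expand_tau_plus: "x > - 1 \<Longrightarrow> expand (\<tau>_plus x) = x"
  and expand_tau_minus: "x < 1 \<Longrightarrow> expand (\<tau>_minus x) = x"
  by (auto simp: expand_def \<tau>_plus_def \<tau>_minus_def field_simps)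

text \<open>Either branch of \<open>expand\<close> is 4x up to an integer shift, and an exponential
  of integer frequency does not see such shifts.\<close>

lemma ee_expand:
  assumes "t \<in> \<int>"
  shows "ee t (expand x) = ee (4 * t) x"
proof -
  have a: "ee t (y + z) = ee t y * ee t z" for y z
    by (simp add: ee_def exp_add[symmetric] algebra_simps)
  have b: "ee t (4 * x) = ee (4 * t) x" by (simp add: ee_def mult_ac)
  show ?thesis
    using a[of "4 * x" 1] a[of "4 * x" "-1"] ee_int[OF assms, of 1] ee_int[OF assms, of "-1"] b
    by (auto simp: expand_def)
qed

section \<open>The isometries \<open>V k\<close> and the formulas for their adjoints\<close>

primrec V :: "nat \<Rightarrow> (real \<Rightarrow> complex) \<Rightarrow> real \<Rightarrow> complex" where
  "V 0 f = (\<lambda>x. ee 1 x * f (expand x))"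
| "V (Suc k) f = (\<lambda>x. V k f (expand x))"

text \<open>The transfer operator of \<open>expand\<close>: by \<open>ip_avg\<close> it is the
  adjoint of composition with \<open>expand\<close>.\<close>

definition avg :: "(real \<Rightarrow> complex) \<Rightarrow> real \<Rightarrow> complex" where
  "avg f x = (f (\<tau>_plus x) + f (\<tau>_minus x)) / 2"

text \<open>\<open>V (Suc k)\<close> composes with \<open>expand\<close> after \<open>V k\<close>.
  Adjoints reverse the order, so here \<open>avg\<close> acts before \<open>V_adj k\<close>;
  \<open>ip_V_adj\<close> confirms that this is the adjoint.\<close>

primrec V_adj :: "nat \<Rightarrow> (real \<Rightarrow> complex) \<Rightarrow> real \<Rightarrow> complex" where
  "V_adj 0 f = avg (\<lambda>x. cnj (ee 1 x) * f x)"
| "V_adj (Suc k) f = V_adj k (avg f)"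

lemma V_add: "V k (\<lambda>x. f x + g x) = (\<lambda>x. V k f x + V k g x)"
  by (induction k) (simp_all add: algebra_simps)

lemma V_scale: "V k (\<lambda>x. c * f x) = (\<lambda>x. c * V k f x)"
  by (induction k) (simp_all add: algebra_simps)

lemma V_adj_add: "V_adj k (\<lambda>x. f x + g x) = (\<lambda>x. V_adj k f x + V_adj k g x)"
proof (induction k arbitrary: f g)
  case 0
  show ?case by (auto simp: avg_def field_simps)
next
  case (Suc k)
  have "avg (\<lambda>x. f x + g x) = (\<lambda>x. avg f x + avg g x)" by (auto simp: avg_def field_simps)
  then show ?case by (simp add: Suc)
qed

lemma V_adj_scale: "V_adj k (\<lambda>x. c * f x) = (\<lambda>x. c * V_adj k f x)"
proof (induction k arbitrary: f)
  case 0
  show ?case by (auto simp: avg_def field_simps)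
next
  case (Suc k)
  have "avg (\<lambda>x. c * f x) = (\<lambda>x. c * avg f x)" by (auto simp: avg_def field_simps)
  then show ?case by (simp add: Suc)
qed

lemma V_ee:
  assumes "t \<in> \<int>"
  shows "V k (ee t) x = ee (4 ^ k * (1 + 4 * t)) x"
proof (induction k arbitrary: x)
  case 0
  show ?case by (simp add: ee_expand[OF assms] ee_add)
next
  case (Suc k)
  have "(4 ^ k * (1 + 4 * t) :: real) \<in> \<int>" using assms by simp
  then show ?case by (simp add: Suc ee_expand mult.assoc)
qed

section \<open>Base-4 digits of the frequencies in \<open>Gam\<close>\<close>

lemma Gam_Ints: "\<gamma> \<in> Gam \<Longrightarrow> \<gamma> \<in> \<int>"
proof -
  assume "\<gamma> \<in> Gam"
  then obtain m a where a: "\<gamma> = (\<Sum>i=0..m. a i * 4 ^ i)" "\<forall>i\<le>m. a i \<in> {0, 1 :: real}"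
    unfolding Gam_def by blast
  have "a i * 4 ^ i \<in> \<int>" if "i \<in> {0..m}" for i
    using a(2)[rule_format, of i] that by auto
  then show ?thesis unfolding a(1) by (rule Ints_sum)
qed

lemma zero_in_Gam: "0 \<in> Gam"
  unfolding Gam_def by (intro CollectI exI[of _ 0] exI[of _ "\<lambda>_. 0"]) auto

lemma Gam_nonempty: "Gam \<noteq> {}"
  using zero_in_Gam by blast

text \<open>Multiplication by 4 moves every base-4 digit up one place, and \<open>c\<close> becomes
  the lowest digit.\<close>

lemma Gam_shift:
  assumes "\<gamma> \<in> Gam" "c \<in> {0, 1}"
  shows "c + 4 * \<gamma> \<in> Gam"
proof -
  obtain m a where a: "\<gamma> = (\<Sum>i=0..m. a i * 4 ^ i)" "\<forall>i\<le>m. a i \<in> {0, 1 :: real}"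
    using assms(1) unfolding Gam_def by blast
  define b where "b i = (case i of 0 \<Rightarrow> c | Suc j \<Rightarrow> a j)" for i
  have "c + 4 * \<gamma> = (\<Sum>i=0..Suc m. b i * 4 ^ i)"
    by (simp add: sum.atLeast0_atMost_Suc_shift b_def a(1) sum_distrib_left mult_ac del: sum.cl_ivl_Suc)
  moreover have "\<forall>i\<le>Suc m. b i \<in> {0, 1}"
    using a(2) assms(2) by (auto simp: b_def split: nat.split)
  ultimately show ?thesis unfolding Gam_def by blast
qed

lemma Gam_V: "\<gamma> \<in> Gam \<Longrightarrow> 4 ^ k * (1 + 4 * \<gamma>) \<in> Gam"
proof (induction k)
  case 0
  then show ?case using Gam_shift[of \<gamma> 1] by simp
next
  case (Suc k)
  then show ?case using Gam_shift[of "4 ^ k * (1 + 4 * \<gamma>)" 0] by (simp add: mult.assoc)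
qed

text \<open>For a nonzero element, \<open>k\<close> is the number of zero digits below the lowest
  digit 1, and \<open>\<gamma>'\<close> is read from the digits above that one. The induction strips
  the lowest digit: a 1 gives \<open>k = 0\<close>, a 0 raises the exponent by one.\<close>

lemma Gam_cases:
  assumes "\<gamma> \<in> Gam"
  obtains "\<gamma> = 0" | k \<gamma>' where "\<gamma>' \<in> Gam" "\<gamma> = 4 ^ k * (1 + 4 * \<gamma>')"
proof -
  have "\<gamma> = 0 \<or> (\<exists>k. \<exists>\<gamma>'\<in>Gam. \<gamma> = 4 ^ k * (1 + 4 * \<gamma>'))"
    if "\<gamma> = (\<Sum>i=0..m. a i * 4 ^ i)" "\<forall>i\<le>m. a i \<in> {0, 1 :: real}" for m a \<gamma>
    using that
  proof (induction m arbitrary: a \<gamma>)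
    case 0
    then have "\<gamma> = 0 \<or> \<gamma> = 4 ^ 0 * (1 + 4 * 0)" by auto
    then show ?case using zero_in_Gam by blast
  next
    case (Suc m)
    define \<delta> where "\<delta> = (\<Sum>i=0..m. a (Suc i) * 4 ^ i)"
    have \<gamma>: "\<gamma> = a 0 + 4 * \<delta>"
      by (simp add: Suc.prems(1) sum.atLeast0_atMost_Suc_shift \<delta>_def sum_distrib_left mult_ac
          del: sum.cl_ivl_Suc)
    have a: "\<forall>i\<le>m. a (Suc i) \<in> {0, 1}" using Suc.prems(2) by auto
    have \<delta>: "\<delta> \<in> Gam" unfolding Gam_def \<delta>_def
      by (intro CollectI exI[of _ m] exI[of _ "\<lambda>i. a (Suc i)"] conjI refl a)
    have "a 0 = 0 \<or> a 0 = 1" using Suc.prems(2) by auto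
    then show ?case
    proof
      assume "a 0 = 1"
      then have "\<gamma> = 4 ^ 0 * (1 + 4 * \<delta>)" by (simp add: \<gamma>)
      then show ?case using \<delta> by blast
    next
      assume 0: "a 0 = 0"
      from Suc.IH[OF \<delta>_def a] show ?case
      proof (elim disjE exE bexE)
        fix k \<gamma>' assume "\<gamma>' \<in> Gam" "\<delta> = 4 ^ k * (1 + 4 * \<gamma>')"
        then have "\<gamma> = 4 ^ Suc k * (1 + 4 * \<gamma>')" by (simp add: \<gamma> 0)
        then show ?case using \<open>\<gamma>' \<in> Gam\<close> by blast
      qed (simp add: \<gamma> 0)
    qed
  qed
  then have "\<gamma> = 0 \<or> (\<exists>k. \<exists>\<gamma>'\<in>Gam. \<gamma> = 4 ^ k * (1 + 4 * \<gamma>'))"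
    using assms unfolding Gam_def mem_Collect_eq by blast
  then show ?thesis using that by blast
qed

lemma cmod_parallelogram:
  "(cmod ((a + b) / 2))\<^sup>2 + (cmod ((a - b) / 2))\<^sup>2 = ((cmod a)\<^sup>2 + (cmod b)\<^sup>2) / 2"
proof -
  have "(cmod ((a + b) / 2))\<^sup>2 = (cmod (a + b))\<^sup>2 / 4" "(cmod ((a - b) / 2))\<^sup>2 = (cmod (a - b))\<^sup>2 / 4"
    by (simp_all add: norm_divide power_divide)
  moreover have "(cmod (a + b))\<^sup>2 + (cmod (a - b))\<^sup>2 = 2 * ((cmod a)\<^sup>2 + (cmod b)\<^sup>2)"
    unfolding cmod_power2 by (simp add: power2_eq_square algebra_simps)
  ultimately show ?thesis by simp
qed

section \<open>The invariant measure\<close>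

locale quarter_measure =
  fixes \<mu> :: "real measure"
  assumes mu: "is_mu_quarter \<mu>"
begin

sublocale prob_space \<mu>
  using mu by (simp add: is_mu_quarter_def)

lemma sets_mu [measurable_cong]: "sets \<mu> = sets borel"
  using mu by (simp add: is_mu_quarter_def)

lemma space_mu [simp]: "space \<mu> = UNIV"
  using sets_eq_imp_space_eq[OF sets_mu] by simp

lemma measure_split:
  assumes [measurable]: "A \<in> sets borel"
  shows "measure \<mu> A = (measure \<mu> (\<tau>_plus -` A) + measure \<mu> (\<tau>_minus -` A)) / 2"
  using mu assms unfolding is_mu_quarter_def by (simp add: measure_distr field_simps)

text \<open>By \<open>measure_split\<close> the preimages of a null set under the two contractions
  have measures that add up to 0, so each is null.\<close>

lemma AE_tau:
  assumes "AE x in \<mu>. P x"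
  shows "AE x in \<mu>. P (\<tau>_plus x)" "AE x in \<mu>. P (\<tau>_minus x)"
proof -
  from AE_E[OF assms] obtain N where N: "{x. \<not> P x} \<subseteq> N" "emeasure \<mu> N = 0" "N \<in> sets \<mu>"
    by auto
  then have [measurable]: "N \<in> sets borel" by (simp add: sets_mu)
  have sum0: "measure \<mu> (\<tau>_plus -` N) + measure \<mu> (\<tau>_minus -` N) = 0"
    using measure_split[of N] N(2) by (simp add: measure_def)
  then have 0: "measure \<mu> (\<tau>_plus -` N) = 0" "measure \<mu> (\<tau>_minus -` N) = 0"
    using measure_nonneg[of \<mu> "\<tau>_plus -` N"] measure_nonneg[of \<mu> "\<tau>_minus -` N"] by linarith+
  have [measurable]: "\<tau>_plus -` N \<in> sets \<mu>" "\<tau>_minus -` N \<in> sets \<mu>"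
    using measurable_sets_borel[OF tau_measurable(1), of N]
      measurable_sets_borel[OF tau_measurable(2), of N] by (auto simp: sets_mu)
  show "AE x in \<mu>. P (\<tau>_plus x)"
    by (rule AE_I[of _ _ "\<tau>_plus -` N"]) (use N(1) 0 in \<open>auto simp: emeasure_eq_measure\<close>)
  show "AE x in \<mu>. P (\<tau>_minus x)"
    by (rule AE_I[of _ _ "\<tau>_minus -` N"]) (use N(1) 0 in \<open>auto simp: emeasure_eq_measure\<close>)
qed

text \<open>If \<open>|\<tau>\<^sub>\<plusminus> x| \<ge> r \<ge> 1\<close>, then \<open>|x| \<ge> 3r\<close>; so the mass outside \<open>[-r, r]\<close> is at most the mass
  outside \<open>[-3r, 3r]\<close>.\<close>

lemma AE_support: "AE x in \<mu>. \<bar>x\<bar> < 1"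
proof -
  define T where "T r = {x :: real. r \<le> \<bar>x\<bar>}" for r
  have T[measurable]: "T r \<in> sets borel" for r unfolding T_def by measurable
  have step: "measure \<mu> (T r) \<le> measure \<mu> (T (3 * r))" if "r \<ge> 1" for r
  proof -
    have "measure \<mu> (\<tau>_plus -` T r) \<le> measure \<mu> (T (3 * r))"
      by (rule finite_measure_mono) (use that in \<open>auto simp: T_def sets_mu \<tau>_plus_def\<close>)
    moreover have "measure \<mu> (\<tau>_minus -` T r) \<le> measure \<mu> (T (3 * r))"
      by (rule finite_measure_mono) (use that in \<open>auto simp: T_def sets_mu \<tau>_minus_def\<close>)
    ultimately show ?thesis using measure_split[OF T, of r] by simp
  qed
  have iter: "measure \<mu> (T 1) \<le> measure \<mu> (T (3 ^ n))" for n
  proof (induction n)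
    case (Suc n)
    then show ?case using step[of "3 ^ n"] by simp
  qed simp
  \<comment> \<open>The tails decrease to the empty set, so their masses tend to 0, while by
    \<open>iter\<close> each of them is at least the mass of \<open>T 1\<close>.\<close>
  have "(\<lambda>n. measure \<mu> (T (3 ^ n))) \<longlonglongrightarrow> measure \<mu> (\<Inter>n. T (3 ^ n))"
  proof (rule finite_Lim_measure_decseq)
    show "decseq (\<lambda>n. T (3 ^ n))"
    proof (intro decseq_SucI subsetI)
      fix n x assume "x \<in> T (3 ^ Suc n)"
      then have "3 * 3 ^ n \<le> \<bar>x\<bar>" by (simp add: T_def)
      moreover have "(0::real) \<le> 3 ^ n" by simp
      ultimately have "3 ^ n \<le> \<bar>x\<bar>" by linarith
      then show "x \<in> T (3 ^ n)" by (simp add: T_def)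
    qed
  qed (auto simp: sets_mu)
  also have "(\<Inter>n. T (3 ^ n)) = {}"
  proof -
    have "x \<notin> (\<Inter>n. T (3 ^ n))" for x
      using real_arch_pow[of 3 "\<bar>x\<bar>"] by (auto simp: T_def not_le)
    then show ?thesis by blast
  qed
  finally have "measure \<mu> (T 1) \<le> 0"
    by (intro LIMSEQ_le_const) (use iter in auto)
  then have "measure \<mu> (T 1) = 0" by (simp add: measure_le_0_iff)
  then show ?thesis
    by (intro AE_I[of _ _ "T 1"]) (auto simp: T_def emeasure_eq_measure sets_mu)
qed

section \<open>Invariance of \<open>\<mu>\<close> under \<open>expand\<close>, and integrals split
  over the two branches\<close>

lemma AE_expand_tau: "AE x in \<mu>. expand (\<tau>_plus x) = x" "AE x in \<mu>. expand (\<tau>_minus x) = x"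
proof -
  show "AE x in \<mu>. expand (\<tau>_plus x) = x"
    using AE_support by eventually_elim (rule expand_tau_plus, simp)
  show "AE x in \<mu>. expand (\<tau>_minus x) = x"
    using AE_support by eventually_elim (rule expand_tau_minus, simp)
qed

text \<open>Pulling \<open>A\<close> back by \<open>expand\<close> and then by either contraction
  gives \<open>A\<close> again up to a null set, so both halves in \<open>measure_split\<close>
  contribute the mass of \<open>A\<close>.\<close>

lemma distr_expand: "distr \<mu> borel expand = \<mu>"
proof (rule measure_eqI)
  fix A assume "A \<in> sets (distr \<mu> borel expand)"
  then have [measurable]: "A \<in> sets borel" by simp
  have m: "expand -` A \<in> sets borel"
    using measurable_sets_borel[OF expand_measurable, of A] by simp
  have m': "\<tau>_plus -` (expand -` A) \<in> sets borel" "\<tau>_minus -` (expand -` A) \<in> sets borel"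
    using measurable_sets_borel[OF tau_measurable(1) m] measurable_sets_borel[OF tau_measurable(2) m] by auto
  have "measure \<mu> (\<tau>_plus -` (expand -` A)) = measure \<mu> A"
    by (rule finite_measure_eq_AE) (use AE_expand_tau(1) m' in \<open>auto simp: sets_mu\<close>)
  moreover have "measure \<mu> (\<tau>_minus -` (expand -` A)) = measure \<mu> A"
    by (rule finite_measure_eq_AE) (use AE_expand_tau(2) m' in \<open>auto simp: sets_mu\<close>)
  ultimately have "measure \<mu> (expand -` A) = measure \<mu> A"
    using measure_split[OF m] by simp
  then show "emeasure (distr \<mu> borel expand) A = emeasure \<mu> A"
    by (simp add: emeasure_distr emeasure_eq_measure)
qed (simp add: sets_mu)

text \<open>\<open>\<mu>\<close> is half the sum of the two image measures, so each of them is at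
  most twice \<open>\<mu>\<close>. This domination is what lets integrability pass to compositions
  with the contractions.\<close>

lemma distr_tau_le:
  "distr \<mu> borel \<tau>_plus \<le> scale_measure 2 \<mu>" "distr \<mu> borel \<tau>_minus \<le> scale_measure 2 \<mu>"
proof -
  have *: "distr \<mu> borel \<tau> \<le> scale_measure 2 \<mu>"
    if [measurable]: "\<tau> \<in> borel_measurable borel" and le: "\<And>A. A \<in> sets borel \<Longrightarrow> measure \<mu> (\<tau> -` A) \<le> 2 * measure \<mu> A" for \<tau>
  proof (subst le_measure)
    show "\<forall>A\<in>sets (distr \<mu> borel \<tau>). emeasure (distr \<mu> borel \<tau>) A \<le> emeasure (scale_measure 2 \<mu>) A"
    proof
      fix A assume "A \<in> sets (distr \<mu> borel \<tau>)"
      then have A[measurable]: "A \<in> sets borel" by simp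
      have "ennreal (measure \<mu> (\<tau> -` A)) \<le> ennreal (2 * measure \<mu> A)"
        using le[OF A] by (rule ennreal_leI)
      then show "emeasure (distr \<mu> borel \<tau>) A \<le> emeasure (scale_measure 2 \<mu>) A"
        by (simp add: emeasure_distr emeasure_eq_measure sets_mu ennreal_mult)
    qed
  qed (simp add: sets_mu)
  show "distr \<mu> borel \<tau>_plus \<le> scale_measure 2 \<mu>"
  proof (rule *)
    fix A :: "real set" assume "A \<in> sets borel"
    show "measure \<mu> (\<tau>_plus -` A) \<le> 2 * measure \<mu> A"
      by (subst measure_split[OF \<open>A \<in> sets borel\<close>]) simp
  qed measurable
  show "distr \<mu> borel \<tau>_minus \<le> scale_measure 2 \<mu>"
  proof (rule *)
    fix A :: "real set" assume "A \<in> sets borel"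
    show "measure \<mu> (\<tau>_minus -` A) \<le> 2 * measure \<mu> A"
      by (subst measure_split[OF \<open>A \<in> sets borel\<close>]) simp
  qed measurable
qed

lemma integrable_tau:
  fixes h :: "real \<Rightarrow> 'b::{banach, second_countable_topology}"
  assumes "integrable \<mu> h"
  shows "integrable \<mu> (\<lambda>x. h (\<tau>_plus x))" "integrable \<mu> (\<lambda>x. h (\<tau>_minus x))"
proof -
  have [measurable]: "h \<in> borel_measurable borel"
    using borel_measurable_integrable[OF assms] by (simp add: measurable_cong_sets[OF sets_mu refl])
  have *: "integrable \<mu> (\<lambda>x. h (\<tau> x))"
    if [measurable]: "\<tau> \<in> borel_measurable borel" and le: "distr \<mu> borel \<tau> \<le> scale_measure 2 \<mu>" for \<tau>
  proof (rule integrableI_bounded)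
    have "(\<integral>\<^sup>+x. ennreal (norm (h (\<tau> x))) \<partial>\<mu>) = (\<integral>\<^sup>+x. ennreal (norm (h x)) \<partial>distr \<mu> borel \<tau>)"
      by (subst nn_integral_distr) auto
    also have "\<dots> \<le> (\<integral>\<^sup>+x. ennreal (norm (h x)) \<partial>scale_measure 2 \<mu>)"
      by (rule nn_integral_mono_measure) (use le in \<open>auto simp: sets_mu\<close>)
    also have "\<dots> = 2 * (\<integral>\<^sup>+x. ennreal (norm (h x)) \<partial>\<mu>)"
      by (rule nn_integral_scale_measure) auto
    also have "\<dots> < \<infinity>"
      using assms by (auto simp: integrable_iff_bounded ennreal_mult_less_top)
    finally show "(\<integral>\<^sup>+x. ennreal (norm (h (\<tau> x))) \<partial>\<mu>) < \<infinity>" .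
  qed measurable
  show "integrable \<mu> (\<lambda>x. h (\<tau>_plus x))" "integrable \<mu> (\<lambda>x. h (\<tau>_minus x))"
    using *[OF tau_measurable(1) distr_tau_le(1)] *[OF tau_measurable(2) distr_tau_le(2)] by simp_all
qed

text \<open>The self-similarity of \<open>\<mu>\<close> is given on sets only. It extends from
  indicator functions through sums and dominated limits to all integrable functions.\<close>

lemma integral_split:
  fixes h :: "real \<Rightarrow> 'b::{banach, second_countable_topology}"
  assumes "integrable \<mu> h"
  shows "(\<integral>x. h x \<partial>\<mu>) = (1/2) *\<^sub>R ((\<integral>x. h (\<tau>_plus x) \<partial>\<mu>) + (\<integral>x. h (\<tau>_minus x) \<partial>\<mu>))"
  using assms
proof (induction rule: integrable_induct)
  case (base A c)
  then have [measurable]: "A \<in> sets borel" by (simp add: sets_mu)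
  \<comment> \<open>Stated for an arbitrary map \<open>\<tau>\<close>, so that the identity covers
    the left-hand side of the claim; \<open>conv\<close> below is used in the same way.\<close>
  have m: "(\<integral>x. indicator A (\<tau> x) *\<^sub>R c \<partial>\<mu>) = measure \<mu> (\<tau> -` A) *\<^sub>R c"
    if "\<tau> \<in> borel_measurable borel" for \<tau>
  proof -
    have "\<tau> -` A \<in> sets \<mu>"
      using measurable_sets_borel[OF that, of A] by (simp add: sets_mu)
    moreover have "(\<lambda>x. indicator A (\<tau> x) *\<^sub>R c) = (\<lambda>x. indicator (\<tau> -` A) x *\<^sub>R c)"
      by (auto simp: fun_eq_iff indicator_def)
    ultimately show ?thesis by (simp add: emeasure_eq_measure)
  qed
  have "measure \<mu> A *\<^sub>R c
      = (1/2) *\<^sub>R (measure \<mu> (\<tau>_plus -` A) *\<^sub>R c + measure \<mu> (\<tau>_minus -` A) *\<^sub>R c)"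
    by (subst measure_split) (simp_all add: scaleR_add_left scaleR_add_right add_divide_distrib)
  then show ?case using m[of "\<lambda>x. x"] m[OF tau_measurable(1)] m[OF tau_measurable(2)] by simp
next
  case (add f g)
  then show ?case by (simp add: integrable_tau algebra_simps)
next
  case (lim f s)
  have [measurable]: "f \<in> borel_measurable borel" "\<And>i. s i \<in> borel_measurable borel"
    using lim.hyps(1)[THEN borel_measurable_integrable] lim.hyps(4)[THEN borel_measurable_integrable] by (simp_all add: measurable_cong_sets[OF sets_mu refl])
  \<comment> \<open>The factor 2 in the dominating function is the bound on the approximating
    functions that \<open>integrable_induct\<close> supplies.\<close>
  have conv: "(\<lambda>i. \<integral>x. s i (\<tau> x) \<partial>\<mu>) \<longlonglongrightarrow> (\<integral>x. f (\<tau> x) \<partial>\<mu>)"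
    if [measurable]: "\<tau> \<in> borel_measurable borel" and "integrable \<mu> (\<lambda>x. f (\<tau> x))" for \<tau>
    by (rule integral_dominated_convergence[where w="\<lambda>x. 2 * norm (f (\<tau> x))"])
      (use that lim.hyps(2,3) in auto)
  have "(\<lambda>i. (1/2) *\<^sub>R ((\<integral>x. s i (\<tau>_plus x) \<partial>\<mu>) + (\<integral>x. s i (\<tau>_minus x) \<partial>\<mu>)))
     \<longlonglongrightarrow> (1/2) *\<^sub>R ((\<integral>x. f (\<tau>_plus x) \<partial>\<mu>) + (\<integral>x. f (\<tau>_minus x) \<partial>\<mu>))"
    by (rule tendsto_scaleR[OF tendsto_const
        tendsto_add[OF conv[OF tau_measurable(1) integrable_tau(1)[OF lim.hyps(4)]]
          conv[OF tau_measurable(2) integrable_tau(2)[OF lim.hyps(4)]]]])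
  then have "(\<lambda>i. \<integral>x. s i x \<partial>\<mu>) \<longlonglongrightarrow> (1/2) *\<^sub>R ((\<integral>x. f (\<tau>_plus x) \<partial>\<mu>) + (\<integral>x. f (\<tau>_minus x) \<partial>\<mu>))"
    by (simp only: lim.IH)
  moreover have "(\<lambda>i. \<integral>x. s i x \<partial>\<mu>) \<longlonglongrightarrow> (\<integral>x. f x \<partial>\<mu>)"
    using conv[of "\<lambda>x. x"] lim.hyps(4) by simp
  ultimately show ?case by (rule LIMSEQ_unique[rotated])
qed

lemma measurable_mu [simp]: "borel_measurable \<mu> = borel_measurable borel"
  by (rule measurable_cong_sets[OF sets_mu refl])

lemma AE_expand:
  assumes "AE x in \<mu>. P x"
  shows "AE x in \<mu>. P (expand x)"
  using AE_distrD[of expand \<mu> borel P] assms unfolding distr_expand by simp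

lemma integral_expand:
  fixes h :: "real \<Rightarrow> 'b::{banach, second_countable_topology}"
  assumes "h \<in> borel_measurable borel"
  shows "(\<integral>x. h (expand x) \<partial>\<mu>) = (\<integral>x. h x \<partial>\<mu>)"
  using integral_distr[of expand \<mu> borel h] assms unfolding distr_expand by simp

lemma integrable_expand:
  fixes h :: "real \<Rightarrow> 'b::{banach, second_countable_topology}"
  assumes "integrable \<mu> h"
  shows "integrable \<mu> (\<lambda>x. h (expand x))"
  using integrable_distr[of expand \<mu> borel h] assms unfolding distr_expand by simp

lemma sq_integrable_expand:
  assumes "f \<in> sq_integrable \<mu>"
  shows "(\<lambda>x. f (expand x)) \<in> sq_integrable \<mu>"
proof -
  have [measurable]: "f \<in> borel_measurable borel" using sq_integrableD(1)[OF assms] by simp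
  show ?thesis
    using integrable_expand[OF sq_integrableD(2)[OF assms]] by (simp add: sq_integrable_def)
qed

lemma sq_integrable_tau:
  assumes "f \<in> sq_integrable \<mu>"
  shows "(\<lambda>x. f (\<tau>_plus x)) \<in> sq_integrable \<mu>" "(\<lambda>x. f (\<tau>_minus x)) \<in> sq_integrable \<mu>"
proof -
  have [measurable]: "f \<in> borel_measurable borel" using sq_integrableD(1)[OF assms] by simp
  show "(\<lambda>x. f (\<tau>_plus x)) \<in> sq_integrable \<mu>" "(\<lambda>x. f (\<tau>_minus x)) \<in> sq_integrable \<mu>"
    using integrable_tau[OF sq_integrableD(2)[OF assms]] by (simp_all add: sq_integrable_def)
qed

lemma sq_integrable_ee_mult:
  assumes "f \<in> sq_integrable \<mu>"
  shows "(\<lambda>x. ee t x * f x) \<in> sq_integrable \<mu>" "(\<lambda>x. cnj (ee t x) * f x) \<in> sq_integrable \<mu>"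
  by (rule sq_integrable_bounded_mult[OF assms, where C=1]; simp)+

lemma sq_integrable_ee: "ee t \<in> sq_integrable \<mu>"
  using sq_integrable_ee_mult(1)[OF sq_integrable_const[of 1]] by simp

lemma sq_integrable_avg:
  assumes "f \<in> sq_integrable \<mu>"
  shows "avg f \<in> sq_integrable \<mu>"
proof -
  have "(\<lambda>x. (1/2) * (f (\<tau>_plus x) + f (\<tau>_minus x))) \<in> sq_integrable \<mu>"
    by (intro sq_integrable_scale sq_integrable_add sq_integrable_tau assms)
  then show ?thesis by (simp add: avg_def[abs_def])
qed

section \<open>Orthogonality relations and adjoints of the isometries\<close>

lemma V_sq: "f \<in> sq_integrable \<mu> \<Longrightarrow> V k f \<in> sq_integrable \<mu>"
  by (induction k) (auto intro: sq_integrable_ee_mult sq_integrable_expand)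

lemma V_adj_sq: "f \<in> sq_integrable \<mu> \<Longrightarrow> V_adj k f \<in> sq_integrable \<mu>"
  by (induction k arbitrary: f) (auto intro: sq_integrable_ee_mult sq_integrable_avg)

lemma V_cong_AE: "AE x in \<mu>. f x = g x \<Longrightarrow> AE x in \<mu>. V k f x = V k g x"
proof (induction k)
  case 0
  from AE_expand[OF 0] show ?case by eventually_elim simp
next
  case (Suc k)
  from AE_expand[OF Suc.IH[OF Suc.prems]] show ?case by simp
qed

lemma avg_cong_AE: "AE x in \<mu>. f x = g x \<Longrightarrow> AE x in \<mu>. avg f x = avg g x"
proof -
  assume "AE x in \<mu>. f x = g x"
  from AE_tau[OF this] show ?thesis by eventually_elim (simp add: avg_def)
qed

lemma V_adj_cong_AE: "AE x in \<mu>. f x = g x \<Longrightarrow> AE x in \<mu>. V_adj k f x = V_adj k g x"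
proof (induction k arbitrary: f g)
  case 0
  then have "AE x in \<mu>. cnj (ee 1 x) * f x = cnj (ee 1 x) * g x" by eventually_elim simp
  from avg_cong_AE[OF this] show ?case by simp
next
  case (Suc k)
  from Suc.IH[OF avg_cong_AE[OF Suc.prems]] show ?case by simp
qed

lemma ip_expand:
  assumes "f \<in> sq_integrable \<mu>" "g \<in> sq_integrable \<mu>"
  shows "ip \<mu> (\<lambda>x. f (expand x)) (\<lambda>x. g (expand x)) = ip \<mu> f g"
proof -
  have [measurable]: "f \<in> borel_measurable borel" "g \<in> borel_measurable borel"
    using assms[THEN sq_integrableD(1)] by simp_all
  show ?thesis unfolding ip_def
    by (rule integral_expand[of "\<lambda>x. f x * cnj (g x)"]) measurable
qed

text \<open>The two preimages of a point under \<open>expand\<close> differ by \<open>1/2\<close>, so \<open>ee 1\<close> takes opposite values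
  there.\<close>

lemma ip_ee_expand:
  assumes "f \<in> sq_integrable \<mu>" "g \<in> sq_integrable \<mu>"
  shows "ip \<mu> (\<lambda>x. ee 1 x * f (expand x)) (\<lambda>x. g (expand x)) = 0"
proof -
  have [measurable]: "f \<in> borel_measurable borel" "g \<in> borel_measurable borel"
    using assms[THEN sq_integrableD(1)] by simp_all
  let ?h = "\<lambda>x. ee 1 x * f (expand x) * cnj (g (expand x))"
  have i: "integrable \<mu> ?h"
    by (intro integrable_ip sq_integrable_ee_mult sq_integrable_expand assms)
  have "(\<integral>x. ?h (\<tau>_plus x) \<partial>\<mu>) = (\<integral>x. ee 1 (\<tau>_plus x) * f x * cnj (g x) \<partial>\<mu>)"
    by (intro integral_cong_AE, measurable) (use AE_expand_tau(1) in \<open>eventually_elim, simp\<close>)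
  moreover have "(\<integral>x. ?h (\<tau>_minus x) \<partial>\<mu>) = (\<integral>x. - (ee 1 (\<tau>_plus x) * f x * cnj (g x)) \<partial>\<mu>)"
    by (intro integral_cong_AE, measurable) (use AE_expand_tau(2) in \<open>eventually_elim, simp add: ee_1_tau\<close>)
  ultimately show ?thesis unfolding ip_def integral_split[OF i] by simp
qed

text \<open>Invariance under \<open>expand\<close> strips the compositions common to both sides. For
  equal indices the unimodular factors \<open>ee 1\<close> then cancel; for different indices one
  side is left as \<open>V 0\<close> and the other as a composition with \<open>expand\<close>, so
  \<open>ip_ee_expand\<close> applies.\<close>

lemma ip_V:
  assumes "f \<in> sq_integrable \<mu>" "g \<in> sq_integrable \<mu>"
  shows "ip \<mu> (V k f) (V l g) = (if k = l then ip \<mu> f g else 0)"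
proof (induction k arbitrary: l)
  case 0
  show ?case
  proof (cases l)
    case 0
    have "a * p * cnj (a * q) = (a * cnj a) * (p * cnj q)" for a p q :: complex
      by (simp add: mult_ac)
    then have "ip \<mu> (V 0 f) (V 0 g) = ip \<mu> (\<lambda>x. f (expand x)) (\<lambda>x. g (expand x))"
      unfolding ip_def V.simps by (simp only: ee_mult_cnj mult_1)
    then show ?thesis using 0 ip_expand[OF assms] by simp
  next
    case (Suc m)
    then show ?thesis using ip_ee_expand[OF assms(1) V_sq[OF assms(2), of m]] by simp
  qed
next
  case (Suc k)
  show ?case
  proof (cases l)
    case 0
    then show ?thesis
      using ip_ee_expand[OF assms(2) V_sq[OF assms(1), of k]] ip_commute[of \<mu> "V (Suc k) f" "V 0 g"]
      by simp
  next
    case (Suc m)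
    then show ?thesis using ip_expand[OF V_sq[OF assms(1), of k] V_sq[OF assms(2), of m]] Suc.IH[of m] by simp
  qed
qed

text \<open>A constant is its own composition with \<open>expand\<close>, so the argument for
  distinct indices in \<open>ip_V\<close> applies to it.\<close>

lemma ip_V_const:
  assumes "f \<in> sq_integrable \<mu>"
  shows "ip \<mu> (V k f) (\<lambda>x. c) = 0"
proof (induction k)
  case 0
  show ?case using ip_ee_expand[OF assms sq_integrable_const[of c]] by simp
next
  case (Suc k)
  then show ?case using ip_expand[OF V_sq[OF assms, of k] sq_integrable_const[of c]] by simp
qed

lemma nsq_V: "f \<in> sq_integrable \<mu> \<Longrightarrow> nsq \<mu> (V k f) = nsq \<mu> f"
  using ip_V[of f f k k] by (simp add: ip_self)

lemma V_diff: "V k (\<lambda>x. f x - g x) = (\<lambda>x. V k f x - V k g x)"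
  using V_add[of k f "\<lambda>x. - 1 * g x"] unfolding V_scale by simp

text \<open>Split the integral over the two branches; on each of them \<open>expand\<close> undoes
  the contraction almost everywhere.\<close>

lemma ip_avg:
  assumes "f \<in> sq_integrable \<mu>" "g \<in> sq_integrable \<mu>"
  shows "ip \<mu> (\<lambda>x. g (expand x)) f = ip \<mu> g (avg f)"
proof -
  have [measurable]: "f \<in> borel_measurable borel" "g \<in> borel_measurable borel"
    using assms[THEN sq_integrableD(1)] by simp_all
  let ?h = "\<lambda>x. g (expand x) * cnj (f x)"
  have i: "integrable \<mu> ?h"
    by (intro integrable_ip sq_integrable_expand assms)
  have "(\<integral>x. ?h (\<tau>_plus x) \<partial>\<mu>) = (\<integral>x. g x * cnj (f (\<tau>_plus x)) \<partial>\<mu>)"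
    by (intro integral_cong_AE, measurable) (use AE_expand_tau(1) in \<open>eventually_elim, simp\<close>)
  moreover have "(\<integral>x. ?h (\<tau>_minus x) \<partial>\<mu>) = (\<integral>x. g x * cnj (f (\<tau>_minus x)) \<partial>\<mu>)"
    by (intro integral_cong_AE, measurable) (use AE_expand_tau(2) in \<open>eventually_elim, simp\<close>)
  ultimately have "ip \<mu> (\<lambda>x. g (expand x)) f
      = (1/2) *\<^sub>R ((\<integral>x. g x * cnj (f (\<tau>_plus x)) \<partial>\<mu>) + (\<integral>x. g x * cnj (f (\<tau>_minus x)) \<partial>\<mu>))"
    unfolding ip_def integral_split[OF i] by simp
  also have "\<dots> = (\<integral>x. (1/2) *\<^sub>R (g x * cnj (f (\<tau>_plus x)) + g x * cnj (f (\<tau>_minus x))) \<partial>\<mu>)"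
    using integrable_ip[OF assms(2) sq_integrable_tau(1)[OF assms(1)]]
      integrable_ip[OF assms(2) sq_integrable_tau(2)[OF assms(1)]] by simp
  also have "\<dots> = ip \<mu> g (avg f)"
    unfolding ip_def
    by (rule Bochner_Integration.integral_cong[OF refl]) (simp add: avg_def scaleR_conv_of_real field_simps)
  finally show ?thesis .
qed

lemma ip_V_adj:
  assumes "f \<in> sq_integrable \<mu>" "g \<in> sq_integrable \<mu>"
  shows "ip \<mu> (V k g) f = ip \<mu> g (V_adj k f)"
  using assms(1)
proof (induction k arbitrary: f)
  case 0
  have "ip \<mu> (V 0 g) f = ip \<mu> (\<lambda>x. g (expand x)) (\<lambda>x. cnj (ee 1 x) * f x)"
    unfolding ip_def by (rule Bochner_Integration.integral_cong[OF refl]) (simp add: mult_ac)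
  then show ?case using ip_avg[OF sq_integrable_ee_mult(2)[OF 0] assms(2), of 1] by simp
next
  case (Suc k)
  then show ?case
    using ip_avg[OF Suc.prems V_sq[OF assms(2), of k]] Suc.IH[OF sq_integrable_avg[OF Suc.prems]] by simp
qed

text \<open>By \<open>ee_1_tau\<close>, \<open>avg f\<close> and \<open>V_adj 0 f\<close> are, up to
  a unimodular factor, half the sum and half the difference of the values of \<open>f\<close> at the
  two preimages. The parallelogram law and \<open>integral_split\<close> finish the
  computation.\<close>

lemma nsq_avg:
  assumes f: "f \<in> sq_integrable \<mu>"
  shows "nsq \<mu> (avg f) + nsq \<mu> (V_adj 0 f) = nsq \<mu> f"
proof -
  have "nsq \<mu> (avg f) + nsq \<mu> (V_adj 0 f) = (\<integral>x. (cmod (avg f x))\<^sup>2 + (cmod (V_adj 0 f x))\<^sup>2 \<partial>\<mu>)"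
    unfolding nsq_def
    using sq_integrableD(2)[OF sq_integrable_avg[OF f]] sq_integrableD(2)[OF V_adj_sq[OF f], of 0]
    by simp
  also have "\<dots> = (\<integral>x. ((cmod (f (\<tau>_plus x)))\<^sup>2 + (cmod (f (\<tau>_minus x)))\<^sup>2) / 2 \<partial>\<mu>)"
  proof (rule Bochner_Integration.integral_cong[OF refl])
    fix x
    have "V_adj 0 f x = cnj (ee 1 (\<tau>_plus x)) * ((f (\<tau>_plus x) - f (\<tau>_minus x)) / 2)"
      by (simp add: avg_def ee_1_tau field_simps)
    then have "cmod (V_adj 0 f x) = cmod ((f (\<tau>_plus x) - f (\<tau>_minus x)) / 2)"
      by (simp only: norm_mult complex_mod_cnj norm_ee mult_1)
    then show "(cmod (avg f x))\<^sup>2 + (cmod (V_adj 0 f x))\<^sup>2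
        = ((cmod (f (\<tau>_plus x)))\<^sup>2 + (cmod (f (\<tau>_minus x)))\<^sup>2) / 2"
      using cmod_parallelogram[of "f (\<tau>_plus x)" "f (\<tau>_minus x)"] by (simp only: avg_def)
  qed
  also have "\<dots> = nsq \<mu> f"
    unfolding nsq_def integral_split[OF sq_integrableD(2)[OF f]]
    using integrable_tau[OF sq_integrableD(2)[OF f]] by simp
  finally show ?thesis .
qed

text \<open>The induction peels off coefficient 0: the later coefficients of \<open>f\<close> are
  those of \<open>avg f\<close>, and \<open>nsq_avg\<close> says exactly how much norm is left for
  them.\<close>

lemma bessel:
  assumes "f \<in> sq_integrable \<mu>"
  shows "(\<Sum>k<n. nsq \<mu> (V_adj k f)) \<le> nsq \<mu> f"
  using assms
proof (induction n arbitrary: f)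
  case 0
  show ?case by (simp add: nsq_nonneg)
next
  case (Suc n)
  have "(\<Sum>k<Suc n. nsq \<mu> (V_adj k f)) = nsq \<mu> (V_adj 0 f) + (\<Sum>k<n. nsq \<mu> (V_adj k (avg f)))"
    by (simp add: sum.lessThan_Suc_shift del: sum.lessThan_Suc V_adj.simps(1))
  also have "\<dots> \<le> nsq \<mu> f"
    using Suc.IH[OF sq_integrable_avg[OF Suc.prems]] nsq_avg[OF Suc.prems] by linarith
  finally show ?case .
qed

section \<open>Orthogonal series with terms in the ranges of the \<open>V k\<close>\<close>

lemma nsq_sum_V:
  assumes "finite I" "\<And>k. x k \<in> sq_integrable \<mu>"
  shows "nsq \<mu> (\<lambda>t. \<Sum>k\<in>I. V k (x k) t) = (\<Sum>k\<in>I. nsq \<mu> (x k))"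
proof -
  have sq: "V k (x k) \<in> sq_integrable \<mu>" for k by (intro V_sq assms)
  have "complex_of_real (nsq \<mu> (\<lambda>t. \<Sum>k\<in>I. V k (x k) t))
      = (\<Sum>k\<in>I. \<Sum>l\<in>I. ip \<mu> (V k (x k)) (V l (x l)))"
    unfolding ip_self[symmetric]
    by (simp add: ip_sum_left ip_sum_right sq sq_integrable_sum)
  also have "\<dots> = of_real (\<Sum>k\<in>I. nsq \<mu> (x k))"
    using assms by (simp add: ip_V ip_self)
  finally show ?thesis using of_real_eq_iff by blast
qed

text \<open>Partial sums of the series that rebuilds a function from a constant part
  \<open>c\<close> and coordinates \<open>x k\<close>.\<close>

definition psum :: "complex \<Rightarrow> (nat \<Rightarrow> real \<Rightarrow> complex) \<Rightarrow> nat \<Rightarrow> real \<Rightarrow> complex" where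
  "psum c x n = (\<lambda>t. c + (\<Sum>k<n. V k (x k) t))"

lemma psum_sq:
  assumes "\<And>k. x k \<in> sq_integrable \<mu>"
  shows "psum c x n \<in> sq_integrable \<mu>"
  unfolding psum_def by (intro sq_integrable_add sq_integrable_const sq_integrable_sum V_sq assms)

lemma ip_psum:
  assumes "\<And>k. x k \<in> sq_integrable \<mu>" "w \<in> sq_integrable \<mu>"
  shows "ip \<mu> (psum c x n) w = c * ip \<mu> (\<lambda>t. 1) w + (\<Sum>k<n. ip \<mu> (V k (x k)) w)"
proof -
  have "ip \<mu> (psum c x n) w = ip \<mu> (\<lambda>t. c * 1) w + ip \<mu> (\<lambda>t. \<Sum>k<n. V k (x k) t) w"
    unfolding psum_def
    by (subst ip_add_left) (auto intro!: sq_integrable_const sq_integrable_sum V_sq assms)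
  also have "ip \<mu> (\<lambda>t. \<Sum>k<n. V k (x k) t) w = (\<Sum>k<n. ip \<mu> (V k (x k)) w)"
    by (rule ip_sum_left[OF V_sq[OF assms(1)] assms(2)])
  finally show ?thesis unfolding ip_scale_left .
qed

text \<open>By \<open>nsq_sum_V\<close> the squared distance of two partial sums is a block of the
  given convergent series, so the partial sums form a Cauchy sequence.\<close>

lemma psum_convergent:
  assumes x: "\<And>k. x k \<in> sq_integrable \<mu>" and summ: "summable (\<lambda>k. nsq \<mu> (x k))"
  shows "\<exists>z\<in>sq_integrable \<mu>. (\<lambda>n. nsq \<mu> (\<lambda>t. psum c x n t - z t)) \<longlonglongrightarrow> 0"
proof (rule L2_complete)
  show "psum c x n \<in> sq_integrable \<mu>" for n by (rule psum_sq[OF x])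
  fix e :: real assume "e > 0"
  then obtain N where N: "\<And>m n. m \<ge> N \<Longrightarrow> norm (sum (\<lambda>k. nsq \<mu> (x k)) {m..<n}) < e"
    using summ unfolding summable_Cauchy by blast
  have *: "nsq \<mu> (\<lambda>t. psum c x n t - psum c x m t) \<le> e" if "N \<le> m" "m \<le> n" for m n
  proof -
    have "(\<lambda>t. psum c x n t - psum c x m t) = (\<lambda>t. \<Sum>k\<in>{m..<n}. V k (x k) t)"
    proof
      fix t
      show "psum c x n t - psum c x m t = (\<Sum>k\<in>{m..<n}. V k (x k) t)"
        using sum_diff_nat_ivl[of 0 m n "\<lambda>k. V k (x k) t"] that(2)
        by (simp add: psum_def lessThan_atLeast0)
    qed
    then have "nsq \<mu> (\<lambda>t. psum c x n t - psum c x m t) = (\<Sum>k\<in>{m..<n}. nsq \<mu> (x k))"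
      using nsq_sum_V[of "{m..<n}" x] x by simp
    then show ?thesis using N[OF that(1), of n] by simp
  qed
  show "\<exists>N. \<forall>m\<ge>N. \<forall>n\<ge>N. nsq \<mu> (\<lambda>t. psum c x m t - psum c x n t) \<le> e"
  proof (intro exI[of _ N] allI impI)
    fix m n assume mn: "N \<le> m" "N \<le> n"
    show "nsq \<mu> (\<lambda>t. psum c x m t - psum c x n t) \<le> e"
    proof (cases "n \<le> m")
      case True
      then show ?thesis by (rule *[OF mn(2)])
    next
      case False
      then show ?thesis using *[OF mn(1), of n] nsq_diff_commute[of \<mu> "psum c x m" "psum c x n"] by simp
    qed
  qed
qed

text \<open>Testing with \<open>w = f - g\<close> makes the squared norm of the difference
  vanish.\<close>

lemma AE_eq_weak:
  assumes f: "f \<in> sq_integrable \<mu>" and g: "g \<in> sq_integrable \<mu>"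
    and eq: "\<And>w. w \<in> sq_integrable \<mu> \<Longrightarrow> ip \<mu> f w = ip \<mu> g w"
  shows "AE x in \<mu>. f x = g x"
proof -
  let ?d = "\<lambda>x. f x - g x"
  have d: "?d \<in> sq_integrable \<mu>" by (rule sq_integrable_diff[OF f g])
  have "complex_of_real (nsq \<mu> ?d) = 0"
    unfolding ip_self[symmetric] ip_diff_left[OF f g d] using eq[OF d] by simp
  then have "AE x in \<mu>. f x - g x = 0" using nsq_eq_0_iff[OF d] by simp
  then show ?thesis by simp
qed

lemma ip_1_1: "ip \<mu> (\<lambda>t. 1) (\<lambda>t. 1) = 1"
  using prob_space by (simp add: ip_def)

text \<open>By orthogonality the inner products of the partial sums with 1 and with any
  \<open>V k w\<close> are eventually constant, so the limit \<open>z\<close> has the same ones. The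
  adjoint relation turns the latter into the coordinates of \<open>z\<close>.\<close>

lemma psum_limit:
  assumes x: "\<And>k. x k \<in> sq_integrable \<mu>" and z: "z \<in> sq_integrable \<mu>"
    and lim: "(\<lambda>n. nsq \<mu> (\<lambda>t. psum c x n t - z t)) \<longlonglongrightarrow> 0"
  shows "ip \<mu> z (\<lambda>t. 1) = c" "AE t in \<mu>. V_adj k z t = x k t"
proof -
  note limip = tendsto_ip_left[OF psum_sq[OF x] z _ lim]
  have eq: "ip \<mu> z w = C" if "w \<in> sq_integrable \<mu>" "\<And>n. n > N \<Longrightarrow> ip \<mu> (psum c x n) w = C" for w N C
  proof (rule LIMSEQ_unique[OF limip[OF that(1)]])
    show "(\<lambda>n. ip \<mu> (psum c x n) w) \<longlonglongrightarrow> C"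
      by (rule tendsto_eventually, rule eventually_mono[OF eventually_gt_at_top[of N]]) (rule that(2))
  qed
  show "ip \<mu> z (\<lambda>t. 1) = c"
  proof (rule eq[OF sq_integrable_const])
    show "ip \<mu> (psum c x n) (\<lambda>t. 1) = c" for n
      unfolding ip_psum[OF x sq_integrable_const] ip_1_1 by (simp add: ip_V_const x)
  qed
  show "AE t in \<mu>. V_adj k z t = x k t"
  proof (rule AE_eq_weak[OF V_adj_sq[OF z] x])
    fix w assume w: "w \<in> sq_integrable \<mu>"
    have "ip \<mu> z (V k w) = ip \<mu> (x k) w"
    \<comment> \<open>\<open>psum c x n\<close> runs over indices below \<open>n\<close>, so term
      \<open>k\<close> is present exactly when \<open>n > k\<close>.\<close>
    proof (rule eq[OF V_sq[OF w], of k])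
      fix n assume n: "k < n"
      have "(\<Sum>l<n. ip \<mu> (V l (x l)) (V k w)) = ip \<mu> (x k) w"
        using n by (simp add: ip_V x w)
      moreover have "ip \<mu> (\<lambda>t. 1) (V k w) = 0"
        using ip_V_const[OF w, of k 1] ip_commute[of \<mu> "\<lambda>t. 1" "V k w"] by simp
      ultimately show "ip \<mu> (psum c x n) (V k w) = ip \<mu> (x k) w"
        unfolding ip_psum[OF x V_sq[OF w]] by simp
    qed
    then show "ip \<mu> (V_adj k z) w = ip \<mu> (x k) w"
      using ip_V_adj[OF z w, of k] ip_commute[of \<mu> z "V k w"] ip_commute[of \<mu> "V_adj k z" w] by simp
  qed
qed

end

section \<open>The unitary operator\<close>

locale quarter_unitary = quarter_measure +
  fixes U :: "(real \<Rightarrow> complex) set \<Rightarrow> (real \<Rightarrow> complex) set"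
  assumes onb: "orthonormal_basis (L2 \<mu>) Gam (\<lambda>\<gamma>. l2class \<mu> (ee \<gamma>))"
    and unitary_U: "unitary (L2 \<mu>) (L2 \<mu>) U"
    and U_ee: "\<And>\<gamma>. \<gamma> \<in> Gam \<Longrightarrow> U (l2class \<mu> (ee \<gamma>)) = l2class \<mu> (ee (5 * \<gamma>))"
begin

text \<open>A lift of \<open>U\<close> to functions through chosen representatives. It depends only
  on the class of its argument, but it is linear only almost everywhere.\<close>

definition u :: "(real \<Rightarrow> complex) \<Rightarrow> real \<Rightarrow> complex" where
  "u f = l2rep (U (l2class \<mu> f))"

lemma U_carr: "A \<in> carr (L2 \<mu>) \<Longrightarrow> U A \<in> carr (L2 \<mu>)"
  using unitary_U by (auto simp: unitary_def bij_betw_def)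

lemma u_sq: "f \<in> sq_integrable \<mu> \<Longrightarrow> u f \<in> sq_integrable \<mu>"
  unfolding u_def by (intro l2rep_sq(1) U_carr l2class_in_carr)

lemma class_u: "f \<in> sq_integrable \<mu> \<Longrightarrow> l2class \<mu> (u f) = U (l2class \<mu> f)"
  unfolding u_def by (intro l2rep_sq(2) U_carr l2class_in_carr)

lemma u_cong: "AE x in \<mu>. f x = g x \<Longrightarrow> u f = u g"
  by (simp add: u_def l2class_cong)

lemma ip_u:
  assumes "f \<in> sq_integrable \<mu>" "g \<in> sq_integrable \<mu>"
  shows "ip \<mu> (u f) (u g) = ip \<mu> f g"
proof -
  have "ip \<mu> (u f) (u g) = vinner (L2 \<mu>) (U (l2class \<mu> f)) (U (l2class \<mu> g))"
    by (simp add: vinner_L2 u_def)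
  also have "\<dots> = vinner (L2 \<mu>) (l2class \<mu> f) (l2class \<mu> g)"
    using unitary_U by (simp add: unitary_def l2class_in_carr assms)
  also have "\<dots> = ip \<mu> f g" by (simp add: vinner_L2 ip_l2rep assms)
  finally show ?thesis .
qed

lemma u_add:
  assumes "f \<in> sq_integrable \<mu>" "g \<in> sq_integrable \<mu>"
  shows "AE x in \<mu>. u (\<lambda>x. f x + g x) x = u f x + u g x"
proof -
  have "l2class \<mu> (u (\<lambda>x. f x + g x)) = U (vadd (L2 \<mu>) (l2class \<mu> f) (l2class \<mu> g))"
    by (simp add: class_u sq_integrable_add vadd_l2class assms)
  also have "\<dots> = vadd (L2 \<mu>) (U (l2class \<mu> f)) (U (l2class \<mu> g))"
    using unitary_U by (simp add: unitary_def l2class_in_carr assms)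
  also have "\<dots> = l2class \<mu> (\<lambda>x. u f x + u g x)"
    by (simp add: class_u[symmetric] vadd_l2class u_sq assms)
  finally show ?thesis by (simp add: l2class_eq_iff u_sq sq_integrable_add assms)
qed

lemma u_scale:
  assumes "f \<in> sq_integrable \<mu>"
  shows "AE x in \<mu>. u (\<lambda>x. c * f x) x = c * u f x"
proof -
  have "l2class \<mu> (u (\<lambda>x. c * f x)) = U (vscale (L2 \<mu>) c (l2class \<mu> f))"
    by (simp add: class_u sq_integrable_scale vscale_l2class assms)
  also have "\<dots> = vscale (L2 \<mu>) c (U (l2class \<mu> f))"
    using unitary_U by (simp add: unitary_def l2class_in_carr assms)
  also have "\<dots> = l2class \<mu> (\<lambda>x. c * u f x)"
    by (simp add: class_u[symmetric] vscale_l2class u_sq assms)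
  finally show ?thesis by (simp add: l2class_eq_iff u_sq sq_integrable_scale assms)
qed

lemma nsq_u_diff:
  assumes "f \<in> sq_integrable \<mu>" "g \<in> sq_integrable \<mu>"
  shows "nsq \<mu> (\<lambda>x. u f x - u g x) = nsq \<mu> (\<lambda>x. f x - g x)"
proof -
  note d = sq_integrable_diff[OF assms]
  have "AE x in \<mu>. u f x = u (\<lambda>x. f x - g x) x + u g x"
    using u_add[OF d assms(2)] by simp
  then have "AE x in \<mu>. u f x - u g x = u (\<lambda>x. f x - g x) x" by eventually_elim simp
  then have "nsq \<mu> (\<lambda>x. u f x - u g x) = nsq \<mu> (u (\<lambda>x. f x - g x))"
    by (intro nsq_cong_AE) (auto intro: sq_integrable_diff u_sq assms)
  also have "complex_of_real \<dots> = of_real (nsq \<mu> (\<lambda>x. f x - g x))"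
    using ip_u[OF d d] by (simp add: ip_self)
  finally show ?thesis using of_real_eq_iff by blast
qed

lemma u_ee: "\<gamma> \<in> Gam \<Longrightarrow> AE x in \<mu>. u (ee \<gamma>) x = ee (5 * \<gamma>) x"
  unfolding u_def U_ee by (rule l2rep_l2class(2)[OF sq_integrable_ee])

lemma u_surj:
  assumes "f \<in> sq_integrable \<mu>"
  shows "\<exists>g\<in>sq_integrable \<mu>. AE x in \<mu>. u g x = f x"
proof -
  have "l2class \<mu> f \<in> U ` carr (L2 \<mu>)"
    using unitary_U l2class_in_carr[OF assms] by (simp add: unitary_def bij_betw_def)
  then obtain g where g: "g \<in> sq_integrable \<mu>" "l2class \<mu> f = U (l2class \<mu> g)" by (auto simp: carr_L2)
  then have "AE x in \<mu>. u g x = f x"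
    using class_u[OF g(1)] l2class_eq_iff[OF u_sq[OF g(1)], of f] by simp
  then show ?thesis using g(1) by blast
qed

text \<open>The intertwining relation is a comparison of frequencies on the basis. Both sides are
  linear and preserve the norm, so it extends to all of L2 by density.\<close>

lemma u_V:
  assumes "f \<in> sq_integrable \<mu>"
  shows "AE x in \<mu>. u (V k f) x = V k (\<lambda>x. ee 1 x * u f x) x"
  using onb Gam_nonempty sq_integrable_ee assms
proof (induction rule: orthonormal_basis_induct)
  case (basis \<gamma>)
  have "V k (ee \<gamma>) = ee (4 ^ k * (1 + 4 * \<gamma>))" by (rule ext) (rule V_ee[OF Gam_Ints[OF basis]])
  then have 1: "AE x in \<mu>. u (V k (ee \<gamma>)) x = ee (5 * (4 ^ k * (1 + 4 * \<gamma>))) x"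
    using u_ee[OF Gam_V[OF basis]] by simp
  from u_ee[OF basis] have "AE x in \<mu>. ee 1 x * u (ee \<gamma>) x = ee (1 + 5 * \<gamma>) x"
    by eventually_elim (simp add: ee_add)
  from V_cong_AE[OF this, of k]
  have 2: "AE x in \<mu>. V k (\<lambda>x. ee 1 x * u (ee \<gamma>) x) x = V k (ee (1 + 5 * \<gamma>)) x" .
  \<comment> \<open>This frequency may lie outside \<open>Gam\<close> (for example 6), which is why
    \<open>V_ee\<close> is stated for all integers.\<close>
  have "1 + 5 * \<gamma> \<in> \<int>" using Gam_Ints[OF basis] by simp
  from V_ee[OF this] have 3: "V k (ee (1 + 5 * \<gamma>)) x = ee (5 * (4 ^ k * (1 + 4 * \<gamma>))) x" for x
    by (simp add: algebra_simps)
  from 1 2 show ?case by eventually_elim (simp only: 3)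
next
  case (cong f g)
  then show ?case using u_cong[OF cong(3)] u_cong[OF V_cong_AE[OF cong(3)]] by simp
next
  case (add f g)
  have "AE x in \<mu>. ee 1 x * u (\<lambda>x. f x + g x) x = ee 1 x * u f x + ee 1 x * u g x"
    using u_add[OF add(1,2)] by eventually_elim (simp add: algebra_simps)
  from V_cong_AE[OF this, of k] u_add[OF V_sq[OF add(1)] V_sq[OF add(2)], of k k] add(3,4)
  show ?case unfolding V_add by eventually_elim simp
next
  case (scale f c)
  have "AE x in \<mu>. ee 1 x * u (\<lambda>x. c * f x) x = c * (ee 1 x * u f x)"
    using u_scale[OF scale(1), of c] by eventually_elim (simp add: algebra_simps)
  from V_cong_AE[OF this, of k] u_scale[OF V_sq[OF scale(1)], of c k] scale(2)
  show ?case unfolding V_scale by eventually_elim simp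
next
  case (closed f)
  define d where "d = (\<lambda>x. u (V k f) x - V k (\<lambda>x. ee 1 x * u f x) x)"
  have sq: "(\<lambda>x. ee 1 x * u f x) \<in> sq_integrable \<mu>" if "f \<in> sq_integrable \<mu>" for f
    by (intro sq_integrable_ee_mult u_sq that)
  have d: "d \<in> sq_integrable \<mu>"
    unfolding d_def by (intro sq_integrable_diff u_sq V_sq sq closed)
  \<comment> \<open>Each of the two terms produced by \<open>nsq_diff_le\<close> has weight 2 and
    reduces to the squared distance of \<open>f\<close> and \<open>g\<close>, which is below
    \<open>e\<close>.\<close>
  have "nsq \<mu> d \<le> 4 * e" if e: "e > 0" for e
  proof -
    obtain g where g: "g \<in> sq_integrable \<mu>" "AE x in \<mu>. u (V k g) x = V k (\<lambda>x. ee 1 x * u g x) x"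
      "nsq \<mu> (\<lambda>x. f x - g x) < e" using closed(2)[OF e] by blast
    have "nsq \<mu> d \<le> 2 * nsq \<mu> (\<lambda>x. u (V k f) x - u (V k g) x)
        + 2 * nsq \<mu> (\<lambda>x. u (V k g) x - V k (\<lambda>x. ee 1 x * u f x) x)"
      unfolding d_def by (intro nsq_diff_le u_sq V_sq sq closed(1) g(1))
    also have "nsq \<mu> (\<lambda>x. u (V k f) x - u (V k g) x) = nsq \<mu> (\<lambda>x. f x - g x)"
      using nsq_u_diff[OF V_sq[OF closed(1)] V_sq[OF g(1)], of k k]
        nsq_V[OF sq_integrable_diff[OF closed(1) g(1)], of k] by (simp add: V_diff)
    also have "nsq \<mu> (\<lambda>x. u (V k g) x - V k (\<lambda>x. ee 1 x * u f x) x)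
        = nsq \<mu> (V k (\<lambda>x. ee 1 x * u g x - ee 1 x * u f x))"
    proof (rule nsq_cong_AE)
      show "AE x in \<mu>. u (V k g) x - V k (\<lambda>x. ee 1 x * u f x) x
          = V k (\<lambda>x. ee 1 x * u g x - ee 1 x * u f x) x"
        using g(2) unfolding V_diff by eventually_elim simp
    qed (intro sq_integrable_diff V_sq sq u_sq closed(1) g(1))+
    also have "\<dots> = nsq \<mu> (\<lambda>x. ee 1 x * u g x - ee 1 x * u f x)"
      by (intro nsq_V sq_integrable_diff sq closed(1) g(1))
    also have "\<dots> = nsq \<mu> (\<lambda>x. u g x - u f x)"
      by (simp add: nsq_def norm_mult right_diff_distrib[symmetric])
    also have "\<dots> = nsq \<mu> (\<lambda>x. f x - g x)"
      using nsq_u_diff[OF g(1) closed(1)] nsq_diff_commute[of \<mu> g f] by simp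
    finally show ?thesis using g(3) by simp
  qed
  from this[of "e / 4" for e] have "nsq \<mu> d \<le> e" if "e > 0" for e using that by simp
  then have "nsq \<mu> d = 0" using nsq_nonneg[of \<mu> d] field_le_epsilon[of "nsq \<mu> d" 0] by simp
  then show ?case using nsq_eq_0_iff[OF d] by (simp add: d_def)
qed

text \<open>By \<open>Gam_cases\<close> every basis exponential is the constant 1 or of the form
  \<open>V k (ee \<gamma>')\<close>. So \<open>y\<close> is orthogonal to the basis, by density to
  every function, and in particular to itself.\<close>

lemma AE_0_of_orthogonal:
  assumes y: "y \<in> sq_integrable \<mu>" and y1: "ip \<mu> y (\<lambda>t. 1) = 0"
    and yV: "\<And>k w. w \<in> sq_integrable \<mu> \<Longrightarrow> ip \<mu> y (V k w) = 0"
  shows "AE x in \<mu>. y x = 0"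
proof -
  have "ip \<mu> f y = 0" if "f \<in> sq_integrable \<mu>" for f
    using onb Gam_nonempty sq_integrable_ee that
  proof (induction rule: orthonormal_basis_induct)
    case (basis \<gamma>)
    then show ?case
    proof (cases rule: Gam_cases)
      case 1
      then show ?thesis using y1 ip_commute[of \<mu> "\<lambda>t. 1" y] by (simp add: ee_0)
    next
      case (2 k \<gamma>')
      then have "ee \<gamma> = V k (ee \<gamma>')" using V_ee[OF Gam_Ints, of \<gamma>' k] by (simp add: fun_eq_iff)
      then show ?thesis
        using yV[OF sq_integrable_ee, of k \<gamma>'] ip_commute[of \<mu> "V k (ee \<gamma>')" y] by simp
    qed
  next
    case (cong f g)
    have "ip \<mu> f y = ip \<mu> g y" by (rule ip_cong_AE) (use cong y in auto)
    then show ?case using cong by simp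
  next
    case (add f g)
    then show ?case by (simp add: ip_add_left y)
  next
    case (scale f c)
    then show ?case by (simp add: ip_scale_left)
  next
    case (closed f)
    have "(cmod (ip \<mu> f y))\<^sup>2 \<le> 0 + e" if e: "e > 0" for e
    proof -
      \<comment> \<open>The summand 1 keeps the divisor positive even if \<open>y\<close> is
        null.\<close>
      have "e / (nsq \<mu> y + 1) > 0" using e nsq_nonneg[of \<mu> y] by simp
      from closed(2)[OF this] obtain g where g: "g \<in> sq_integrable \<mu>" "ip \<mu> g y = 0"
        "nsq \<mu> (\<lambda>x. f x - g x) < e / (nsq \<mu> y + 1)" by blast
      have "(cmod (ip \<mu> f y))\<^sup>2 = (cmod (ip \<mu> (\<lambda>x. f x - g x) y))\<^sup>2"
        by (simp add: ip_diff_left closed g y)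
      also have "\<dots> \<le> nsq \<mu> (\<lambda>x. f x - g x) * nsq \<mu> y"
        by (intro cauchy_schwarz sq_integrable_diff closed g y)
      also have "\<dots> \<le> e / (nsq \<mu> y + 1) * (nsq \<mu> y + 1)"
        using g(3) nsq_nonneg[of \<mu> y] nsq_nonneg[of \<mu> "\<lambda>x. f x - g x"] by (intro mult_mono) auto
      also have "\<dots> = 0 + e" using nsq_nonneg[of \<mu> y] by simp
      finally show ?thesis .
    qed
    then have "(cmod (ip \<mu> f y))\<^sup>2 \<le> 0" by (rule field_le_epsilon)
    then show ?case by simp
  qed
  from this[OF y] show ?thesis using nsq_eq_0_iff[OF y] by (simp add: ip_self)
qed

text \<open>The dual form of \<open>u_V\<close>. As \<open>U\<close> is onto and \<open>ee 1\<close>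
  is unimodular, any test function \<open>w\<close> is \<open>ee 1\<close> times some
  \<open>u v\<close>. Then \<open>V k w = u (V k v)\<close> by \<open>u_V\<close>, and unitarity of
  \<open>U\<close> moves everything to the right-hand argument.\<close>

lemma V_adj_u:
  assumes y: "y \<in> sq_integrable \<mu>"
  shows "AE x in \<mu>. V_adj k (u y) x = ee 1 x * u (V_adj k y) x"
proof (rule AE_eq_weak)
  show "V_adj k (u y) \<in> sq_integrable \<mu>" "(\<lambda>x. ee 1 x * u (V_adj k y) x) \<in> sq_integrable \<mu>"
    by (intro V_adj_sq sq_integrable_ee_mult u_sq y)+
  fix w assume w: "w \<in> sq_integrable \<mu>"
  note w' = sq_integrable_ee_mult(2)[OF w, of 1]
  obtain v where v: "v \<in> sq_integrable \<mu>" "AE x in \<mu>. u v x = cnj (ee 1 x) * w x"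
    using u_surj[OF w'] by blast
  have ev: "AE x in \<mu>. ee 1 x * u v x = w x"
    using v(2) by eventually_elim (simp add: mult.assoc[symmetric])
  have "AE x in \<mu>. V k w x = u (V k v) x"
    using V_cong_AE[OF ev, of k] u_V[OF v(1), of k] by eventually_elim simp
  then have "ip \<mu> (V k w) (u y) = ip \<mu> (u (V k v)) (u y)"
    by (intro ip_cong_AE) (auto intro: V_sq u_sq w v y)
  also have "\<dots> = ip \<mu> v (V_adj k y)" by (simp add: ip_u V_sq v y ip_V_adj)
  also have "\<dots> = ip \<mu> (u v) (u (V_adj k y))" by (simp add: ip_u V_adj_sq v y)
  also have "\<dots> = ip \<mu> (\<lambda>x. cnj (ee 1 x) * w x) (u (V_adj k y))"
    by (intro ip_cong_AE v(2)) (auto intro: u_sq V_adj_sq v y w')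
  also have "\<dots> = ip \<mu> w (\<lambda>x. ee 1 x * u (V_adj k y) x)"
    by (simp add: ip_def mult_ac)
  finally have "ip \<mu> w (V_adj k (u y)) = ip \<mu> w (\<lambda>x. ee 1 x * u (V_adj k y) x)"
    by (simp add: ip_V_adj u_sq y w)
  then show "ip \<mu> (V_adj k (u y)) w = ip \<mu> (\<lambda>x. ee 1 x * u (V_adj k y) x) w"
    using ip_commute[of \<mu> _ w] by metis
qed

text \<open>\<open>U\<close> fixes \<open>ee 0\<close>, the constant 1, because 5 times 0 is 0;
  unitarity does the rest.\<close>

lemma ip_u_1:
  assumes "y \<in> sq_integrable \<mu>"
  shows "ip \<mu> (u y) (\<lambda>t. 1) = ip \<mu> y (\<lambda>t. 1)"
proof -
  have "AE x in \<mu>. u (\<lambda>t. 1) x = 1" using u_ee[OF zero_in_Gam] by (simp add: ee_0)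
  then have "ip \<mu> (u y) (\<lambda>t. 1) = ip \<mu> (u y) (u (\<lambda>t. 1))"
    by (intro ip_cong_AE) (auto intro: u_sq assms sq_integrable_const)
  then show ?thesis by (simp add: ip_u assms sq_integrable_const)
qed

text \<open>Through \<open>ip_V_adj\<close>, equal coordinates make the difference orthogonal to
  every range of \<open>V k\<close> and to the constants.\<close>

lemma eq_of_coordinates:
  assumes y: "y \<in> sq_integrable \<mu>" and z: "z \<in> sq_integrable \<mu>"
    and c: "ip \<mu> y (\<lambda>t. 1) = ip \<mu> z (\<lambda>t. 1)"
    and V: "\<And>k. AE t in \<mu>. V_adj k y t = V_adj k z t"
  shows "AE t in \<mu>. y t = z t"
proof -
  have "AE t in \<mu>. y t - z t = 0"
  proof (rule AE_0_of_orthogonal)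
    fix k w assume w: "w \<in> sq_integrable \<mu>"
    have "ip \<mu> w (V_adj k y) = ip \<mu> w (V_adj k z)"
      by (intro ip_cong_AE V) (auto intro: V_adj_sq w y z)
    then have "ip \<mu> (V k w) y = ip \<mu> (V k w) z" by (simp add: ip_V_adj w y z)
    then show "ip \<mu> (\<lambda>t. y t - z t) (V k w) = 0"
      using ip_commute[of \<mu> y "V k w"] ip_commute[of \<mu> z "V k w"]
      by (simp add: ip_diff_left y z V_sq w)
  qed (simp_all add: ip_diff_left y z c sq_integrable_const sq_integrable_diff)
  then show ?thesis by simp
qed

text \<open>The series built from the coordinates of \<open>y\<close> converges to a function with
  these same coordinates, hence to \<open>y\<close>. Its partial sums are then paired with
  \<open>z\<close> term by term.\<close>

lemma parseval:
  assumes y: "y \<in> sq_integrable \<mu>" and z: "z \<in> sq_integrable \<mu>"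
  shows "(\<lambda>k. ip \<mu> (V_adj k y) (V_adj k z)) sums (ip \<mu> y z - ip \<mu> y (\<lambda>t. 1) * cnj (ip \<mu> z (\<lambda>t. 1)))"
proof -
  define c where "c = ip \<mu> y (\<lambda>t. 1)"
  define x where "x k = V_adj k y" for k
  have x: "x k \<in> sq_integrable \<mu>" for k unfolding x_def by (rule V_adj_sq[OF y])
  have "summable (\<lambda>k. nsq \<mu> (x k))"
    using bessel[OF y] by (intro summableI_nonneg_bounded) (auto simp: x_def nsq_nonneg)
  from psum_convergent[OF x this] obtain y' where
    y': "y' \<in> sq_integrable \<mu>" "(\<lambda>n. nsq \<mu> (\<lambda>t. psum c x n t - y' t)) \<longlonglongrightarrow> 0" by blast
  note lim = psum_limit[OF x y']
  have eq: "AE t in \<mu>. y' t = y t"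
    by (rule eq_of_coordinates[OF y'(1) y]) (use lim in \<open>simp_all add: c_def x_def\<close>)
  have "(\<lambda>n. ip \<mu> (psum c x n) z) \<longlonglongrightarrow> ip \<mu> y' z"
    by (rule tendsto_ip_left[OF psum_sq[OF x] y'(1) z y'(2)])
  also have "ip \<mu> y' z = ip \<mu> y z"
    by (intro ip_cong_AE eq) (auto intro: y' y z)
  also have "(\<lambda>n. ip \<mu> (psum c x n) z) =
      (\<lambda>n. c * cnj (ip \<mu> z (\<lambda>t. 1)) + (\<Sum>k<n. ip \<mu> (V_adj k y) (V_adj k z)))"
    unfolding ip_psum[OF x z] ip_commute[of \<mu> "\<lambda>t. 1" z] by (simp add: ip_V_adj z x x_def[symmetric])
  finally have "(\<lambda>n. c * cnj (ip \<mu> z (\<lambda>t. 1)) + (\<Sum>k<n. ip \<mu> (V_adj k y) (V_adj k z)) - c * cnj (ip \<mu> z (\<lambda>t. 1)))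
      \<longlonglongrightarrow> ip \<mu> y z - c * cnj (ip \<mu> z (\<lambda>t. 1))"
    by (intro tendsto_diff tendsto_const)
  then show ?thesis by (simp add: sums_def c_def)
qed

section \<open>The coordinate map as the intertwining unitary\<close>

abbreviation const_space :: "(real \<Rightarrow> complex) set cips" where
  "const_space \<equiv> restrict_space_to (L2 \<mu>) (lin_span (L2 \<mu>) {l2class \<mu> (ee 0)})"

lemma span_ee_0: "lin_span (L2 \<mu>) {l2class \<mu> (ee 0)} = range (\<lambda>c. l2class \<mu> (\<lambda>x. c))"
  unfolding ee_0 by (rule lin_span_const) (rule prob_space_axioms)

text \<open>The first entry is the orthogonal projection onto the constants, since 1 has norm 1 in a
  probability space. Entry \<open>k\<close> of the second is the adjoint of
  \<open>V k\<close>.\<close>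

definition coords :: "(real \<Rightarrow> complex) set \<Rightarrow> (real \<Rightarrow> complex) set \<times> (nat \<Rightarrow> (real \<Rightarrow> complex) set)" where
  "coords Y = (l2class \<mu> (\<lambda>x. ip \<mu> (l2rep Y) (\<lambda>t. 1)), \<lambda>k. l2class \<mu> (V_adj k (l2rep Y)))"

lemma coords_l2class:
  assumes "f \<in> sq_integrable \<mu>"
  shows "coords (l2class \<mu> f) = (l2class \<mu> (\<lambda>x. ip \<mu> f (\<lambda>t. 1)), \<lambda>k. l2class \<mu> (V_adj k f))"
proof -
  have "ip \<mu> (l2rep (l2class \<mu> f)) (\<lambda>t. 1) = ip \<mu> f (\<lambda>t. 1)"
    by (intro ip_cong_AE l2rep_l2class assms sq_integrable_const) auto
  moreover have "l2class \<mu> (V_adj k (l2rep (l2class \<mu> f))) = l2class \<mu> (V_adj k f)" for k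
    by (intro l2class_cong V_adj_cong_AE l2rep_l2class assms)
  ultimately show ?thesis by (simp add: coords_def)
qed

lemma carr_sum: "carr (direct_sum const_space (hilbert_sum (\<lambda>k. L2 \<mu>)))
    = range (\<lambda>c. l2class \<mu> (\<lambda>x. c)) \<times>
      {X. (\<forall>k. X k \<in> carr (L2 \<mu>)) \<and> summable (\<lambda>k. nsq \<mu> (l2rep (X k)))}"
  by (simp add: direct_sum_def hilbert_sum_def restrict_space_to_def span_ee_0 vnorm_L2)

text \<open>Injectivity is \<open>eq_of_coordinates\<close>, and \<open>bessel\<close> puts the
  coordinates into the Hilbert sum. For surjectivity, square-summable data are summed by
  \<open>psum_convergent\<close>, and \<open>psum_limit\<close> recovers them from the sum.\<close>

lemma bij_coords: "bij_betw coords (carr (L2 \<mu>)) (carr (direct_sum const_space (hilbert_sum (\<lambda>k. L2 \<mu>))))"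
  unfolding bij_betw_def
proof
  show "inj_on coords (carr (L2 \<mu>))"
  proof (rule inj_onI)
    fix Y Z assume Y: "Y \<in> carr (L2 \<mu>)" and Z: "Z \<in> carr (L2 \<mu>)" and eq: "coords Y = coords Z"
    note rY = l2rep_sq[OF Y] and rZ = l2rep_sq[OF Z]
    have "l2class \<mu> (\<lambda>x. ip \<mu> (l2rep Y) (\<lambda>t. 1)) = l2class \<mu> (\<lambda>x. ip \<mu> (l2rep Z) (\<lambda>t. 1))"
      using arg_cong[OF eq, of fst] by (simp only: coords_def fst_conv)
    then have "AE x in \<mu>. ip \<mu> (l2rep Y) (\<lambda>t. 1) = ip \<mu> (l2rep Z) (\<lambda>t. 1)"
      by (subst (asm) l2class_eq_iff[OF sq_integrable_const])
    then have "ip \<mu> (l2rep Y) (\<lambda>t. 1) = ip \<mu> (l2rep Z) (\<lambda>t. 1)" by simp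
    moreover have "AE x in \<mu>. V_adj k (l2rep Y) x = V_adj k (l2rep Z) x" for k
    proof -
      have "l2class \<mu> (V_adj k (l2rep Y)) = l2class \<mu> (V_adj k (l2rep Z))"
        using fun_cong[OF arg_cong[OF eq, of snd], of k] by (simp only: coords_def snd_conv)
      then show ?thesis by (subst (asm) l2class_eq_iff[OF V_adj_sq[OF rY(1)]])
    qed
    ultimately have "AE x in \<mu>. l2rep Y x = l2rep Z x" by (rule eq_of_coordinates[OF rY(1) rZ(1)])
    from l2class_cong[OF this] show "Y = Z" by (simp only: rY(2) rZ(2))
  qed
  show "coords ` carr (L2 \<mu>) = carr (direct_sum const_space (hilbert_sum (\<lambda>k. L2 \<mu>)))"
  proof
    show "coords ` carr (L2 \<mu>) \<subseteq> carr (direct_sum const_space (hilbert_sum (\<lambda>k. L2 \<mu>)))"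
    proof
      fix p assume "p \<in> coords ` carr (L2 \<mu>)"
      then obtain f where f: "f \<in> sq_integrable \<mu>" "p = coords (l2class \<mu> f)"
        unfolding carr_L2 by blast
      have "summable (\<lambda>k. nsq \<mu> (V_adj k f))"
        using bessel[OF f(1)] by (intro summableI_nonneg_bounded) (auto simp: nsq_nonneg)
      then show "p \<in> carr (direct_sum const_space (hilbert_sum (\<lambda>k. L2 \<mu>)))"
        unfolding f(2) coords_l2class[OF f(1)] carr_sum
        by (intro SigmaI rangeI CollectI conjI allI l2class_in_carr V_adj_sq f(1))
          (simp only: nsq_l2rep V_adj_sq f(1))
    qed
    show "carr (direct_sum const_space (hilbert_sum (\<lambda>k. L2 \<mu>))) \<subseteq> coords ` carr (L2 \<mu>)"
    proof
      fix p assume "p \<in> carr (direct_sum const_space (hilbert_sum (\<lambda>k. L2 \<mu>)))"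
      then obtain c X where p: "p = (l2class \<mu> (\<lambda>x. c), X)" "\<And>k. X k \<in> carr (L2 \<mu>)"
        "summable (\<lambda>k. nsq \<mu> (l2rep (X k)))" unfolding carr_sum by blast
      note x = l2rep_sq[OF p(2)]
      from psum_convergent[OF x(1) p(3), of c] obtain z where z: "z \<in> sq_integrable \<mu>"
        "(\<lambda>n. nsq \<mu> (\<lambda>t. psum c (\<lambda>k. l2rep (X k)) n t - z t)) \<longlonglongrightarrow> 0" by blast
      note lim = psum_limit[OF x(1) z]
      have "coords (l2class \<mu> z) = p"
        unfolding coords_l2class[OF z(1)] p(1) lim(1) by (simp only: l2class_cong[OF lim(2)] x(2))
      then show "p \<in> coords ` carr (L2 \<mu>)" using l2class_in_carr[OF z(1)] by blast
    qed
  qed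
qed

text \<open>Preservation of the inner product is \<open>parseval\<close>, with its constant term
  moved to the other side.\<close>

lemma unitary_coords: "unitary (L2 \<mu>) (direct_sum const_space (hilbert_sum (\<lambda>k. L2 \<mu>))) coords"
  unfolding unitary_def
proof (intro conjI ballI allI bij_coords)
  let ?K = "direct_sum const_space (hilbert_sum (\<lambda>k. L2 \<mu>))"
  have const: "vadd const_space = vadd (L2 \<mu>)" "vscale const_space = vscale (L2 \<mu>)"
    "vinner const_space = vinner (L2 \<mu>)" by (simp_all add: restrict_space_to_def)
  fix Y assume "Y \<in> carr (L2 \<mu>)"
  then obtain f where f: "f \<in> sq_integrable \<mu>" "Y = l2class \<mu> f" by (auto simp: carr_L2)
  note fs = V_adj_sq[OF f(1)]
  show "coords (vscale (L2 \<mu>) c Y) = vscale ?K c (coords Y)" for c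
    unfolding f(2) vscale_l2class[OF f(1)] coords_l2class[OF f(1)]
      coords_l2class[OF sq_integrable_scale[OF f(1)]]
    by (simp add: direct_sum_def hilbert_sum_def const vscale_l2class sq_integrable_const fs
        ip_scale_left V_adj_scale)
  fix Z assume "Z \<in> carr (L2 \<mu>)"
  then obtain g where g: "g \<in> sq_integrable \<mu>" "Z = l2class \<mu> g" by (auto simp: carr_L2)
  note gs = V_adj_sq[OF g(1)]
  show "coords (vadd (L2 \<mu>) Y Z) = vadd ?K (coords Y) (coords Z)"
    unfolding f(2) g(2) vadd_l2class[OF f(1) g(1)] coords_l2class[OF f(1)] coords_l2class[OF g(1)]
      coords_l2class[OF sq_integrable_add[OF f(1) g(1)]]
    by (simp add: direct_sum_def hilbert_sum_def const vadd_l2class sq_integrable_const fs gs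
        ip_add_left f(1) g(1) V_adj_add)
  have c: "ip \<mu> (\<lambda>x. a) (\<lambda>x. b) = a * cnj b" for a b
    using prob_space by (simp add: ip_def)
  have "ip \<mu> f g = ip \<mu> f (\<lambda>t. 1) * cnj (ip \<mu> g (\<lambda>t. 1)) + (\<Sum>k. ip \<mu> (V_adj k f) (V_adj k g))"
    using sums_unique[OF parseval[OF f(1) g(1)]] by (simp only: diff_eq_eq add.commute)
  then show "vinner ?K (coords Y) (coords Z) = vinner (L2 \<mu>) Y Z"
    unfolding f(2) g(2) coords_l2class[OF f(1)] coords_l2class[OF g(1)]
    by (simp add: direct_sum_def hilbert_sum_def const vinner_L2 ip_l2rep sq_integrable_const fs gs f(1) g(1) c)
qed

text \<open>On the constant part \<open>U\<close> changes nothing by \<open>ip_u_1\<close>, and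
  neither does the projection, whose argument already lies in the span. The remaining entries are
  \<open>V_adj_u\<close>.\<close>

lemma coords_U:
  assumes "Y \<in> carr (L2 \<mu>)"
  shows "coords (U Y) = op_direct_sum (orth_proj (L2 \<mu>) (lin_span (L2 \<mu>) {l2class \<mu> (ee 0)}))
     (op_hilbert_sum (\<lambda>k. mult_op \<mu> (ee 1) \<circ> U)) (coords Y)"
proof -
  obtain f where f: "f \<in> sq_integrable \<mu>" "Y = l2class \<mu> f"
    using assms unfolding carr_L2 by blast
  let ?S = "lin_span (L2 \<mu>) {l2class \<mu> (ee 0)}"
  have sub: "lin_subspace (L2 \<mu>) ?S"
    unfolding span_ee_0
    by (auto simp: lin_subspace_def vadd_l2class vscale_l2class sq_integrable_const intro!: l2class_in_carr)
  have proj: "orth_proj (L2 \<mu>) ?S (l2class \<mu> (\<lambda>x. c)) = l2class \<mu> (\<lambda>x. c)" for c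
  proof (rule orth_proj_of_mem[OF _ sub])
    show "?S \<subseteq> carr (L2 \<mu>)" using sub unfolding lin_subspace_def by (rule conjunct1)
    show "l2class \<mu> (\<lambda>x. c) \<in> ?S" unfolding span_ee_0 by (rule rangeI)
  qed
  have "l2class \<mu> (V_adj k (u f)) = mult_op \<mu> (ee 1) (U (l2class \<mu> (V_adj k f)))" for k
    unfolding class_u[OF V_adj_sq[OF f(1)], symmetric] mult_op_l2class[OF u_sq[OF V_adj_sq[OF f(1)]]]
    by (rule l2class_cong[OF V_adj_u[OF f(1)]])
  then show ?thesis
    unfolding f(2) class_u[OF f(1), symmetric] coords_l2class[OF f(1)] coords_l2class[OF u_sq[OF f(1)]]
    by (simp add: op_direct_sum_def op_hilbert_sum_def proj ip_u_1 f(1))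
qed

end

theorem theorem4p10:
  fixes \<mu> :: "real measure" and U :: "(real \<Rightarrow> complex) set \<Rightarrow> (real \<Rightarrow> complex) set"
  assumes "is_mu_quarter \<mu>"
    and "orthonormal_basis (L2 \<mu>) Gam (\<lambda>\<gamma>. exp_class \<mu> \<gamma>)"
    and "orthonormal_basis (L2 \<mu>) Gam (\<lambda>\<gamma>. exp_class \<mu> (5 * \<gamma>))"
    and "unitary (L2 \<mu>) (L2 \<mu>) U"
    and "\<And>\<gamma>. \<gamma> \<in> Gam \<Longrightarrow> U (exp_class \<mu> \<gamma>) = exp_class \<mu> (5 * \<gamma>)"
  shows "unitarily_equivalent
           (L2 \<mu>) U
           (direct_sum (restrict_space_to (L2 \<mu>) (lin_span (L2 \<mu>) {exp_class \<mu> 0})) (hilbert_sum (\<lambda>k. L2 \<mu>)))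
           (op_direct_sum (orth_proj (L2 \<mu>) (lin_span (L2 \<mu>) {exp_class \<mu> 0}))
                     (op_hilbert_sum (\<lambda>k. mult_op \<mu> (ee 1) \<circ> U)))"
proof -
  interpret quarter_unitary \<mu> U
    by unfold_locales (use assms in auto)
  show ?thesis unfolding unitarily_equivalent_def
    using unitary_coords coords_U by blast
qed

end
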